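(* Consider an indefinite binary quadratic form $Q(x,y)=ax^2+bxy+cy^2$ with $a,b,c>0$ and discriminant $b^2-4ac=1$. Let $w,w'$ be the roots of $cw^2-bw+a=0$, ordered so that $w>w'>0$; then $Q(x,y)=\frac{1}{w-w'}(y+xw)(y+xw')$. Define $$\mathcal{Z}(s;w,w')=\sum_{p\ge1,\,q\ge0}\left(\frac{p(w-w')}{(q+pw)(q+pw')}\right)^s .$$ Then: (1) For a narrow ideal class $\mathscr{B}$ of a real quadratic field $K$ of discriminant $D>0$, with reduced numbers $w_1,\dots,w_r$, $$D^{s/2}\,\widetilde{\zeta}(s,\mathscr{B})=\sum_{k=1}^r\mathcal{Z}(s;w_k,w_k').$$ (2) $\mathcal{Z}(s;w,w')$ is defined in the region $\mathrm{Re}(s)>2$. (3) $\mathcal{Z}(s;w,w')$ has an analytic continuation to the half-plane $\mathrm{Re}(s)>\frac12$, having only two simple poles, at $s=1$ and $s=2$. (4) The Laurent series expansion of $\mathcal{Z}(s;w,w')$ around $s=1$ is given by $$\mathcal{Z}(s;w,w')=\frac{\frac{w-w'}{2ww'}}{s-1}+\widetilde{P}(w,w')+\mathcal{O}(s-1),$$ where $$\widetilde{P}(x,y)=\mathcal{F}_1(x)-\mathcal{F}_1(y)-\frac{x-y}{2xy}\left(\gamma+\log\left(\frac{x-y}{xy}\right)\right).$$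
   Context: For $x\in\mathbb{C}\setminus(-\infty,0]$, let $$\mathcal{F}_1(x)=\sum_{n=1}^\infty\left\{\psi(nx)+\frac{1}{2nx}-\log(nx)\right\}-\frac12\left(\gamma-\log\left(\frac{2\pi}{x}\right)\right),$$ where $\psi=\Gamma'/\Gamma$ is the digamma function and $\gamma$ is Euler's constant. Let $K$ be a real quadratic field of discriminant $D>0$, regarded as a subfield of $\mathbb{R}$; for $w\in K$, $w'$ denotes its Galois conjugate. A number $w\in K$ is reduced if $w>1>w'>0$; such a number has a purely periodic continued fraction expansion of the "minus" type. If $\mathscr{B}$ is a narrow ideal class of $K$ with length $r=\ell(\mathscr{B})$ and cycle $((b_1,\dots,b_r))$ ($b_i\in\mathbb{Z}$, $b_i\ge2$), there are exactly $r$ reduced numbers $w\in K$ for which $\{1,w\}$ is a basis of some ideal in $\mathscr{B}$, namely $$w_k=b_k-\cfrac{1}{b_{k+1}-\cfrac{1}{\ddots-\cfrac{1}{b_r-\cfrac{1}{b_1-\ddots}}}}\qquad(k=1,\dots,r).$$ Put $$Q_k(p,q)=\frac{1}{w_k-w_k'}(q+pw_k)(q+pw_k'),\qquad 1\le k\le r.$$ The partial zeta function $\widetilde{\zeta}(s,\mathscr{B})$ is defined by $$D^{s/2}\,\widetilde{\zeta}(s,\mathscr{B})=\sum_{k=1}^r\ \sum_{p\ge1,\,q\ge0}\frac{p^s}{Q_k(p,q)^s}.$$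
   Formalization: In part (4) the sign before (x−y)/(2xy)·(γ+log((x−y)/(xy))) in P̃ is corrected from minus to plus; the printed sign is false, e.g. for Q=2x²+3xy+y² with w=2, w'=1. *)

theory Defs
  imports
    "HOL-Complex_Analysis.Complex_Analysis"
    "HOL-Library.Landau_Symbols"
    "HOL-Computational_Algebra.Polynomial"
begin

section \<open>The function \<open>F\<^sub>1\<close> and the term \<open>P\<close>\<close>

definition F1 :: "complex \<Rightarrow> complex" where
  "F1 x = (\<Sum>m. let n = of_nat (Suc m) in
             Digamma (n * x) + 1 / (2 * n * x) - Ln (n * x))
          - 1 / 2 * (euler_mascheroni - Ln (2 * of_real pi / x))"

text \<open>
  Some printed versions of this formula have a minus sign in front of
  \<open>(x - y) / (2 x y)\<close>.  The plus sign is the correct one: for \<open>x > y > 0\<close>, with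
  \<open>c = (x - y) / (x y)\<close>, the \<open>q = 0\<close> boundary terms of the double series contribute
  \<open>1/2 c\<^sup>s \<zeta>(s) = (c/2) / (s - 1) + (c/2) (\<gamma> + log c) + O(s - 1)\<close>, so the residue
  \<open>c/2\<close> and the term \<open>(c/2) (\<gamma> + log c)\<close> have the same sign.
\<close>

definition Ptilde :: "complex \<Rightarrow> complex \<Rightarrow> complex" where
  "Ptilde x y = F1 x - F1 y
     + (x - y) / (2 * x * y) * (euler_mascheroni + Ln ((x - y) / (x * y)))"

section \<open>The double series\<close>

definition pq_pairs :: "(nat \<times> nat) set" where
  "pq_pairs = {1..} \<times> UNIV"

definition Z_term :: "real \<Rightarrow> real \<Rightarrow> complex \<Rightarrow> nat \<times> nat \<Rightarrow> complex" where
  "Z_term w w' s = (\<lambda>(p, q).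
     of_real (real p * (w - w') / ((real q + real p * w) * (real q + real p * w'))) powr s)"

definition Z :: "complex \<Rightarrow> real \<Rightarrow> real \<Rightarrow> complex" where
  "Z s w w' = (\<Sum>\<^sub>\<infinity>pq\<in>pq_pairs. Z_term w w' s pq)"

section \<open>Real quadratic fields\<close>

definition real_quadratic_field :: "real set \<Rightarrow> bool" where
  "real_quadratic_field K \<longleftrightarrow>
     0 \<in> K \<and> 1 \<in> K \<and>
     (\<forall>x\<in>K. \<forall>y\<in>K. x + y \<in> K \<and> x * y \<in> K) \<and>
     (\<forall>x\<in>K. - x \<in> K \<and> inverse x \<in> K) \<and>
     vector_space.dim (\<lambda>(r::rat) (x::real). of_rat r * x) K = 2"

definition nontrivial_automorphism :: "real set \<Rightarrow> (real \<Rightarrow> real) \<Rightarrow> bool" where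
  "nontrivial_automorphism K \<sigma> \<longleftrightarrow>
     bij_betw \<sigma> K K \<and>
     (\<forall>x\<in>K. \<forall>y\<in>K. \<sigma> (x + y) = \<sigma> x + \<sigma> y \<and> \<sigma> (x * y) = \<sigma> x * \<sigma> y) \<and>
     (\<exists>x\<in>K. \<sigma> x \<noteq> x)"

definition conj_in :: "real set \<Rightarrow> real \<Rightarrow> real" where
  "conj_in K w = (THE v. \<exists>\<sigma>. nontrivial_automorphism K \<sigma> \<and> v = \<sigma> w)"

definition ring_of_integers :: "real set \<Rightarrow> real set" where
  "ring_of_integers K = {x \<in> K. algebraic_int x}"

definition int_span2 :: "real \<Rightarrow> real \<Rightarrow> real set" where
  "int_span2 \<alpha> \<beta> = {of_int m * \<alpha> + of_int n * \<beta> | m n. True}"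

text \<open>
  Two generators of a lattice of rank two (the ring of integers, or a fractional ideal)
  are automatically linearly independent over the integers, so in the next definition and in
  \<open>reduced_numbers\<close> the equation with \<open>int_span2\<close> says that the two numbers are a basis.
\<close>

definition field_discriminant :: "real set \<Rightarrow> int" where
  "field_discriminant K = (THE D. \<exists>\<alpha> \<beta>. ring_of_integers K = int_span2 \<alpha> \<beta> \<and>
     of_int D = (\<alpha> * conj_in K \<beta> - conj_in K \<alpha> * \<beta>)\<^sup>2)"

section \<open>Narrow ideal classes and their reduced numbers\<close>

definition fractional_ideals :: "real set \<Rightarrow> real set set" where
  "fractional_ideals K = {I. I \<subseteq> K \<and> 0 \<in> I \<and> I \<noteq> {0} \<and>
     (\<forall>x\<in>I. \<forall>y\<in>I. x + y \<in> I) \<and>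
     (\<forall>r\<in>ring_of_integers K. \<forall>x\<in>I. r * x \<in> I) \<and>
     (\<exists>d\<in>ring_of_integers K. d \<noteq> 0 \<and> (\<forall>x\<in>I. d * x \<in> ring_of_integers K))}"

definition narrow_equiv :: "real set \<Rightarrow> (real set \<times> real set) set" where
  "narrow_equiv K = {(I, J). I \<in> fractional_ideals K \<and> J \<in> fractional_ideals K \<and>
     (\<exists>t\<in>K. t > 0 \<and> conj_in K t > 0 \<and> J = (\<lambda>x. t * x) ` I)}"

definition narrow_ideal_classes :: "real set \<Rightarrow> real set set set" where
  "narrow_ideal_classes K = fractional_ideals K // narrow_equiv K"

definition is_reduced :: "real set \<Rightarrow> real \<Rightarrow> bool" where
  "is_reduced K w \<longleftrightarrow> w \<in> K \<and> w > 1 \<and> 1 > conj_in K w \<and> conj_in K w > 0"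

definition reduced_numbers :: "real set \<Rightarrow> real set set \<Rightarrow> real set" where
  "reduced_numbers K \<B> = {w. is_reduced K w \<and> (\<exists>I\<in>\<B>. I = int_span2 1 w)}"

fun minus_cf_convergent :: "(nat \<Rightarrow> int) \<Rightarrow> nat \<Rightarrow> real" where
  "minus_cf_convergent b 0 = of_int (b 0)"
| "minus_cf_convergent b (Suc n) =
     of_int (b 0) - 1 / minus_cf_convergent (\<lambda>i. b (Suc i)) n"

text \<open>
  \<open>cycle_number bs k\<close> is the number \<open>w\<^sub>k\<close>, \<open>1 \<le> k \<le> length bs\<close>, with purely periodic expansion
  \<open>b\<^sub>k - 1/(b\<^sub>k\<^sub>+\<^sub>1 - 1/(...))\<close>.  Since lists are indexed from zero, \<open>b\<^sub>k\<close> is \<open>bs ! (k - 1)\<close>.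
\<close>

definition cycle_number :: "int list \<Rightarrow> nat \<Rightarrow> real" where
  "cycle_number bs k =
     lim (minus_cf_convergent (\<lambda>i. bs ! ((k - 1 + i) mod length bs)))"

text \<open>
  A class has length \<open>r\<close> and cycle \<open>((b\<^sub>1, ..., b\<^sub>r))\<close> if the numbers \<open>w\<^sub>1, ..., w\<^sub>r\<close> are exactly
  its reduced numbers, listed without repetition.  This determines the list \<open>bs\<close> up to
  rotation, and forces it to be a minimal period.
\<close>

definition has_cycle :: "real set \<Rightarrow> real set set \<Rightarrow> int list \<Rightarrow> bool" where
  "has_cycle K \<B> bs \<longleftrightarrow>
     bs \<noteq> [] \<and> (\<forall>b\<in>set bs. b \<ge> 2) \<and>
     bij_betw (cycle_number bs) {1..length bs} (reduced_numbers K \<B>)"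

section \<open>The partial zeta function\<close>

definition reduced_form :: "real set \<Rightarrow> real \<Rightarrow> real \<Rightarrow> real \<Rightarrow> real" where
  "reduced_form K w p q =
     1 / (w - conj_in K w) * ((q + p * w) * (q + p * conj_in K w))"

definition partial_zeta :: "real set \<Rightarrow> complex \<Rightarrow> real set set \<Rightarrow> complex" where
  "partial_zeta K s \<B> =
     (\<Sum>w\<in>reduced_numbers K \<B>. \<Sum>\<^sub>\<infinity>(p, q)\<in>pq_pairs.
        of_nat p powr s / of_real (reduced_form K w (real p) (real q)) powr s)
     / of_int (field_discriminant K) powr (s / 2)"

end

theory Submission
  imports Defs
begin

text \<open>
  Put \<open>\<Delta> = w - w'\<close> and \<open>h(u) = (\<Delta> / ((u + w) (u + w')))\<^sup>s\<close>.  The \<open>(p, q)\<close> term of the double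
  series is \<open>p\<^sup>-\<^sup>s h(q/p)\<close>, so its \<open>p\<close>-th row is, up to a power of \<open>p\<close>, a Riemann sum of \<open>h\<close>
  on \<open>[0, \<infinity>)\<close> with step \<open>1/p\<close>.  Comparing the row with the trapezoid rule gives
    \<open>\<Sum>\<^sub>q p\<^sup>-\<^sup>s h(q/p) = p\<^sup>1\<^sup>-\<^sup>s I(s) + p\<^sup>-\<^sup>s h(0)/2 + R\<^sub>p(s)\<close>,  where  \<open>I(s) = \<integral>\<^sub>0\<^sup>\<infinity> h(u) du\<close>,
  and the error of the rule on the \<open>q\<close>-th interval is at most a constant times
  \<open>\<surd>p / (p + q)\<^sup>3\<close> as long as \<open>Re s > 1/2\<close> and \<open>s\<close> stays bounded.  These errors are summable over
  all \<open>p\<close> and \<open>q\<close>, hence summing over \<open>p\<close> for \<open>Re s > 2\<close> yields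
    \<open>\<Z>(s) = \<zeta>(s - 1) I(s) + \<zeta>(s) h(0)/2 + R(s)\<close>
  with \<open>R\<close> holomorphic for \<open>Re s > 1/2\<close>.  The right-hand side is the continuation
  (\<open>continuation_eq_Z\<close>): the pole of \<open>\<zeta>(s - 1)\<close> at \<open>2\<close> survives because \<open>I(2) \<noteq> 0\<close>, and the
  pole of \<open>\<zeta>(s)\<close> at \<open>1\<close> survives because \<open>h(0) = (\<Delta>/(w w'))\<^sup>s \<noteq> 0\<close>.

  Three ingredients make this explicit.  The values of \<open>\<zeta>\<close> come from the same trapezoid rule applied
  to \<open>x\<^sup>-\<^sup>s\<close>, which gives \<open>\<zeta>(s) - 1/(s - 1)\<close> on \<open>Re s > -1/2\<close>, with value \<open>\<gamma>\<close> at \<open>1\<close> and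
  \<open>1/2\<close> at \<open>0\<close> (so \<open>\<zeta>(0) = -1/2\<close>).  The tails of the integral \<open>I(s)\<close> are incomplete beta
  functions, defined here by their hypergeometric series; what enters the argument is that they form
  an antiderivative of \<open>-h\<close> that vanishes at infinity and is holomorphic in \<open>s\<close>.  Finally, at
  \<open>s = 1\<close> the function \<open>h\<close> is \<open>1/(u + w') - 1/(u + w)\<close>, so \<open>R\<^sub>p(1)\<close> splits into trapezoid errors
  for \<open>1/x\<close>, and these add up to \<open>-(\<psi>(z) + 1/(2z) - log z)\<close> at \<open>z = p w'\<close> and at \<open>z = p w\<close>: this
  is how the series in \<open>\<F>\<^sub>1\<close> enters the constant term.  The rest of that term is
  \<open>\<zeta>(0) I(1) = -(1/2) log (w/w')\<close>, which is the elementary part of \<open>\<F>\<^sub>1(w) - \<F>\<^sub>1(w')\<close>, and the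
  constant term of \<open>\<zeta>(s) c\<^sup>s / 2\<close> with \<open>c = \<Delta>/(w w')\<close>.

  The decomposition over a narrow ideal class is a term-by-term identity: the numbers \<open>w\<^sub>k\<close> list
  the reduced numbers of the class without repetition, so both sides are sums over the same numbers.

  Rows are indexed by \<open>n\<close> with \<open>p = n + 1\<close> throughout.
\<close>

section \<open>Series of holomorphic functions and the trapezoid rule\<close>

lemma suminf_norm_le:
  fixes f :: "nat \<Rightarrow> 'a::banach"
  assumes "\<And>n. norm (f n) \<le> C * g n" "summable g"
  shows "norm (suminf f) \<le> C * suminf g"
proof -
  have s: "summable (\<lambda>n. C * g n)" using assms(2) by (rule summable_mult)
  have "norm (suminf f) \<le> (\<Sum>n. C * g n)"
    by (rule norm_suminf_le) (use assms s in auto)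
  also have "\<dots> = C * suminf g" using assms(2) by (rule suminf_mult)
  finally show ?thesis .
qed

lemma summable_Suc_powr: "a < -1 \<Longrightarrow> summable (\<lambda>n. real (Suc n) powr a)"
  using summable_Suc_iff[of "\<lambda>n. real n powr a"] summable_real_powr_iff[of a] by simp

lemma powr_of_real_exp:
  assumes "r > 0"
  shows "complex_of_real r powr s = exp (s * of_real (ln r))"
  using assms Ln_of_real[OF assms] by (simp add: powr_def)

lemma holomorphic_suminf:
  fixes f :: "nat \<Rightarrow> complex \<Rightarrow> complex"
  assumes "open S" and hol: "\<And>n. f n holomorphic_on S"
    and bound: "\<And>z. z \<in> S \<Longrightarrow>
      \<exists>d h. 0 < d \<and> summable h \<and> (\<forall>n. \<forall>y\<in>ball z d \<inter> S. norm (f n y) \<le> h n)"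
  shows "(\<lambda>z. \<Sum>n. f n z) holomorphic_on S"
proof -
  have "(f n has_field_derivative deriv (f n) z) (at z)" if "z \<in> S" for n z
    using holomorphic_derivI[OF hol \<open>open S\<close> that] .
  moreover have "\<exists>d h. 0 < d \<and> summable h \<and>
      (\<forall>\<^sub>F n in sequentially. \<forall>y\<in>ball z d \<inter> S. norm (f n y) \<le> h n)" if "z \<in> S" for z
    using bound[OF that] by (auto intro!: always_eventually)
  ultimately obtain g g' where g: "\<forall>z\<in>S. (\<lambda>n. f n z) sums g z \<and>
      (\<lambda>n. deriv (f n) z) sums g' z \<and> (g has_field_derivative g' z) (at z)"
    using series_and_derivative_comparison_local[OF \<open>open S\<close>, of f "\<lambda>n. deriv (f n)"] by blast
  then have "g holomorphic_on S"
    using \<open>open S\<close> holomorphic_on_open by blast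
  then show ?thesis
    by (rule holomorphic_transform) (use g in \<open>simp add: sums_iff\<close>)
qed

lemma holomorphic_double_suminf:
  fixes f :: "nat \<Rightarrow> nat \<Rightarrow> complex \<Rightarrow> complex" and a :: "nat \<Rightarrow> real"
  assumes "open S" and hol: "\<And>n q. f n q holomorphic_on S"
    and a: "summable a" "\<And>n. a n \<ge> 0"
    and bound: "\<And>z. z \<in> S \<Longrightarrow> \<exists>d C. 0 < d \<and> (\<forall>n q. \<forall>y\<in>ball z d \<inter> S. norm (f n q y) \<le> C * (a n * a q))"
  shows "(\<lambda>z. \<Sum>n. \<Sum>q. f n q z) holomorphic_on S"
proof (rule holomorphic_suminf[OF \<open>open S\<close>])
  fix n show "(\<lambda>z. \<Sum>q. f n q z) holomorphic_on S"
  proof (rule holomorphic_suminf[OF \<open>open S\<close> hol])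
    fix z assume "z \<in> S"
    then obtain d C where dC: "0 < d" "\<forall>n q. \<forall>y\<in>ball z d \<inter> S. norm (f n q y) \<le> C * (a n * a q)"
      using bound by blast
    show "\<exists>d h. 0 < d \<and> summable h \<and> (\<forall>q. \<forall>y\<in>ball z d \<inter> S. norm (f n q y) \<le> h q)"
      by (rule exI[of _ d], rule exI[of _ "\<lambda>q. C * (a n * a q)"]) (use dC in \<open>auto intro!: summable_mult a\<close>)
  qed
next
  fix z assume "z \<in> S"
  then obtain d C where dC: "0 < d" "\<forall>n q. \<forall>y\<in>ball z d \<inter> S. norm (f n q y) \<le> C * (a n * a q)"
    using bound by blast
  have "norm (\<Sum>q. f n q y) \<le> (C * a n) * suminf a" if "y \<in> ball z d \<inter> S" for n y
    by (rule suminf_norm_le[OF _ a(1)]) (use dC that in \<open>auto simp: mult.assoc\<close>)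
  then show "\<exists>d h. 0 < d \<and> summable h \<and> (\<forall>n. \<forall>y\<in>ball z d \<inter> S. norm (\<Sum>q. f n q y) \<le> h n)"
    by (intro exI[of _ d] exI[of _ "\<lambda>n. (C * a n) * suminf a"])
       (auto intro!: summable_mult2 summable_mult a dC(1))
qed

lemma simple_poleI:
  fixes f g :: "complex \<Rightarrow> complex"
  assumes "open S" "z \<in> S" "g holomorphic_on S" "g z \<noteq> 0"
    and "\<And>s. s \<in> S \<Longrightarrow> s \<noteq> z \<Longrightarrow> f s = g s / (s - z)"
  shows "is_pole f z" "zorder f z = - 1"
proof -
  have "is_pole (\<lambda>s. g s / (s - z) ^ 1) z"
    by (rule is_pole_basic) (use assms in auto)
  moreover have "\<forall>\<^sub>F s in at z. g s / (s - z) ^ 1 = f s"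
    using assms(1,2,5) by (auto simp: eventually_at_topological)
  ultimately show "is_pole f z" by (rule is_pole_transform) simp
  show "zorder f z = - 1"
    by (rule zorder_eqI[OF assms(1-4)]) (use assms(5) in \<open>auto simp: power_int_minus divide_inverse\<close>)
qed

lemma holomorphic_diff_bigo:
  assumes "f holomorphic_on S" "open S" "z \<in> S"
  shows "(\<lambda>s. f s - f z) \<in> O[at z](\<lambda>s. s - z)"
proof (rule bigoI_tendsto)
  have "(f has_field_derivative deriv f z) (at z)" by (rule holomorphic_derivI[OF assms])
  then show "((\<lambda>s. (f s - f z) / (s - z)) \<longlongrightarrow> deriv f z) (at z)"
    by (simp add: has_field_derivative_iff)
  show "\<forall>\<^sub>F s in at z. s - z \<noteq> 0"
    by (auto simp: eventually_at_filter)
qed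

text \<open>
  The error on \<open>[a, z]\<close>, as a function of the right endpoint \<open>z\<close>, vanishes at \<open>a\<close> together with its
  derivative, and its second derivative is \<open>(z - a) f''(z) / 2\<close>.  Two applications of the mean value
  inequality bound it without any integration.
\<close>
lemma trapezoid_error:
  fixes f f' f'' F :: "complex \<Rightarrow> complex" and a \<eta> M :: real
  assumes "\<eta> \<ge> 0"
    and F: "\<And>t. t \<in> {a..a+\<eta>} \<Longrightarrow> (F has_field_derivative f (of_real t)) (at (of_real t))"
    and f: "\<And>t. t \<in> {a..a+\<eta>} \<Longrightarrow> (f has_field_derivative f' (of_real t)) (at (of_real t))"
    and f': "\<And>t. t \<in> {a..a+\<eta>} \<Longrightarrow> (f' has_field_derivative f'' (of_real t)) (at (of_real t))"
    and M: "\<And>t. t \<in> {a..a+\<eta>} \<Longrightarrow> norm (f'' (of_real t)) \<le> M"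
  shows "norm (of_real \<eta> * (f (of_real a) + f (of_real (a+\<eta>))) / 2
               - (F (of_real (a+\<eta>)) - F (of_real a))) \<le> M * \<eta> ^ 3 / 2"
proof -
  define S :: "complex set" where "S = of_real ` {a..a+\<eta>}"
  \<comment> \<open>\<open>E0\<close> is the error on \<open>[a, z]\<close>; \<open>E1\<close> and \<open>E2\<close> are its first two derivatives.\<close>
  define E0 where "E0 z = (z - of_real a) * (f (of_real a) + f z) / 2 - (F z - F (of_real a))" for z
  define E1 where "E1 z = (f (of_real a) - f z) / 2 + (z - of_real a) * f' z / 2" for z
  define E2 where "E2 z = (z - of_real a) * f'' z / 2" for z
  have "S = closed_segment (of_real a) (of_real (a+\<eta>))"
    unfolding S_def closed_segment_of_real using \<open>\<eta> \<ge> 0\<close>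
    by (simp add: closed_segment_eq_real_ivl)
  then have cvx: "convex S" by simp
  have in_S: "of_real a \<in> S" "of_real (a+\<eta>) \<in> S"
    unfolding S_def using \<open>\<eta> \<ge> 0\<close> by (auto simp del: of_real_add)
  have dist: "norm (z - of_real a) \<le> \<eta>" if "z \<in> S" for z
    using that unfolding S_def by (auto simp flip: of_real_diff)
  have "norm (f'' (of_real a)) \<le> M" using \<open>\<eta> \<ge> 0\<close> by (intro M) auto
  then have M0: "M \<ge> 0" by (rule order_trans[OF norm_ge_zero])
  have d1: "(E1 has_field_derivative E2 z) (at z within S)" if "z \<in> S" for z
  proof -
    from that obtain t where t: "t \<in> {a..a+\<eta>}" "z = of_real t" unfolding S_def by blast
    note [derivative_intros] = f[OF t(1), folded t(2)] f'[OF t(1), folded t(2)]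
    have "(E1 has_field_derivative (0 - f' z) / 2 + ((z - of_real a) * f'' z + (1 - 0) * f' z) / 2) (at z)"
      unfolding E1_def by (intro DERIV_cdivide DERIV_mult' derivative_intros)
    also have "(0 - f' z) / 2 + ((z - of_real a) * f'' z + (1 - 0) * f' z) / 2 = E2 z"
      unfolding E2_def by (simp add: field_simps)
    finally show ?thesis by (rule has_field_derivative_at_within)
  qed
  have d0: "(E0 has_field_derivative E1 z) (at z within S)" if "z \<in> S" for z
  proof -
    from that obtain t where t: "t \<in> {a..a+\<eta>}" "z = of_real t" unfolding S_def by blast
    note [derivative_intros] = f[OF t(1), folded t(2)] F[OF t(1), folded t(2)]
    have "(E0 has_field_derivative
        ((z - of_real a) * (0 + f' z) + (1 - 0) * (f (of_real a) + f z)) / 2 - (f z - 0)) (at z)"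
      unfolding E0_def by (intro DERIV_cdivide DERIV_mult' derivative_intros)
    also have "((z - of_real a) * (0 + f' z) + (1 - 0) * (f (of_real a) + f z)) / 2 - (f z - 0) = E1 z"
      unfolding E1_def by (simp add: field_simps)
    finally show ?thesis by (rule has_field_derivative_at_within)
  qed
  have b2: "norm (E2 z) \<le> \<eta> * M / 2" if "z \<in> S" for z
  proof -
    have "norm (f'' z) \<le> M" using that M unfolding S_def by auto
    then show ?thesis unfolding E2_def norm_divide norm_mult
      using mult_mono[OF dist[OF that] _ \<open>\<eta> \<ge> 0\<close>, of "norm (f'' z)" M] by simp
  qed
  have b1: "norm (E1 z) \<le> \<eta> * M / 2 * \<eta>" if "z \<in> S" for z
  proof -
    have "norm (E1 z - E1 (of_real a)) \<le> \<eta> * M / 2 * norm (z - of_real a)"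
      by (rule field_differentiable_bound[OF cvx d1 b2 that in_S(1)])
    also have "\<dots> \<le> \<eta> * M / 2 * \<eta>"
      using dist[OF that] M0 \<open>\<eta> \<ge> 0\<close> by (intro mult_left_mono) auto
    finally show ?thesis by (simp add: E1_def)
  qed
  have "norm (E0 (of_real (a+\<eta>)) - E0 (of_real a)) \<le> \<eta> * M / 2 * \<eta> * norm (of_real (a+\<eta>) - (of_real a::complex))"
    by (rule field_differentiable_bound[OF cvx d0 b1 in_S(2,1)])
  also have "\<dots> = M * \<eta> ^ 3 / 2" using \<open>\<eta> \<ge> 0\<close> by (simp add: power3_eq_cube)
  finally show ?thesis by (simp add: E0_def)
qed

text \<open>
  Adding up the trapezoid rule: the half weights combine to full weights except at \<open>0\<close>, and the
  increments of the antiderivative \<open>\<Phi>\<close> telescope.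
\<close>
lemma sums_trapezoid:
  fixes f \<Phi> :: "nat \<Rightarrow> complex"
  assumes "f \<longlonglongrightarrow> 0" "\<Phi> \<longlonglongrightarrow> L"
    and "(\<lambda>q. (f q + f (Suc q)) / 2 - (\<Phi> (Suc q) - \<Phi> q)) sums R"
  shows "f sums (R + f 0 / 2 + (L - \<Phi> 0))"
proof -
  have eq: "(\<Sum>q<m. (f q + f (Suc q)) / 2 - (\<Phi> (Suc q) - \<Phi> q))
      = (\<Sum>q<m. f q) + (f m - f 0) / 2 - (\<Phi> m - \<Phi> 0)" for m
  proof (induction m)
    case (Suc m)
    show ?case unfolding sum.lessThan_Suc Suc by (simp add: algebra_simps add_divide_distrib diff_divide_distrib)
  qed simp
  have "(\<lambda>m. (\<Sum>q<m. (f q + f (Suc q)) / 2 - (\<Phi> (Suc q) - \<Phi> q)) - (f m - f 0) / 2 + (\<Phi> m - \<Phi> 0))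
      \<longlonglongrightarrow> R - (0 - f 0) / 2 + (L - \<Phi> 0)"
    by (intro tendsto_intros assms(3)[unfolded sums_def] assms) simp
  moreover have "(\<Sum>q<m. (f q + f (Suc q)) / 2 - (\<Phi> (Suc q) - \<Phi> q)) - (f m - f 0) / 2 + (\<Phi> m - \<Phi> 0)
      = (\<Sum>q<m. f q)" for m
    unfolding eq by (simp add: algebra_simps)
  ultimately show ?thesis unfolding sums_def by simp
qed

section \<open>The Riemann zeta function near \<open>0\<close> and \<open>1\<close>\<close>

text \<open>
  The antiderivative of \<open>x\<^sup>-\<^sup>s\<close> that vanishes at \<open>x = 1\<close>.  With this normalisation it is entire
  in \<open>s\<close>, the logarithm filling the removable singularity at \<open>s = 1\<close>.
\<close>
definition power_primitive :: "complex \<Rightarrow> complex \<Rightarrow> complex" where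
  "power_primitive s x = (if s = 1 then Ln x else (x powr (1 - s) - 1) / (1 - s))"

lemma power_primitive_deriv:
  assumes "x \<notin> \<real>\<^sub>\<le>\<^sub>0"
  shows "(power_primitive s has_field_derivative x powr (- s)) (at x)"
proof (cases "s = 1")
  case True
  have "(Ln has_field_derivative inverse x) (at x)" using assms by (rule has_field_derivative_Ln)
  moreover have "power_primitive s = Ln" using True by (auto simp: power_primitive_def)
  moreover have "x \<noteq> 0" using assms by auto
  ultimately show ?thesis using True by (simp add: powr_minus)
next
  case False
  have "((\<lambda>x. (x powr (1 - s) - 1) / (1 - s)) has_field_derivative x powr (- s)) (at x)"
    using assms False by (auto intro!: derivative_eq_intros)
  moreover have "power_primitive s = (\<lambda>x. (x powr (1 - s) - 1) / (1 - s))"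
    using False by (auto simp: power_primitive_def)
  ultimately show ?thesis by simp
qed

lemma power_primitive_holomorphic:
  assumes "x \<noteq> 0"
  shows "(\<lambda>s. power_primitive s x) holomorphic_on S"
proof -
  let ?f = "\<lambda>s. - (x powr (1 - s))"
  have d: "(?f has_field_derivative Ln x) (at 1)"
    using assms by (auto simp: powr_def intro!: derivative_eq_intros)
  have "(\<lambda>z. if z = 1 then deriv ?f 1 else (?f z - ?f 1) / (z - 1)) holomorphic_on UNIV"
    using assms by (intro pole_lemma holomorphic_intros) auto
  moreover have "(if z = 1 then deriv ?f 1 else (?f z - ?f 1) / (z - 1)) = power_primitive z x" for z
  proof (cases "z = 1")
    case False
    then have "z - 1 \<noteq> 0" "1 - z \<noteq> 0" by auto
    then show ?thesis using False assms
      by (simp add: power_primitive_def frac_eq_eq) (simp add: algebra_simps)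
  qed (use DERIV_imp_deriv[OF d] in \<open>simp add: power_primitive_def\<close>)
  ultimately show ?thesis by (auto intro: holomorphic_on_subset)
qed

definition zeta_defect :: "nat \<Rightarrow> complex \<Rightarrow> complex" where
  "zeta_defect n s = (of_nat (Suc n) powr (- s) + of_nat (Suc (Suc n)) powr (- s)) / 2
     - (power_primitive s (of_nat (Suc (Suc n))) - power_primitive s (of_nat (Suc n)))"

lemma zeta_defect_holomorphic: "zeta_defect n holomorphic_on S"
  unfolding zeta_defect_def[abs_def]
  by (intro holomorphic_intros power_primitive_holomorphic) (auto simp del: of_nat_Suc)

lemma zeta_defect_bound:
  assumes "Re s \<ge> -1/2"
  shows "norm (zeta_defect n s) \<le> norm s * norm (s + 1) * real (Suc n) powr (- 3/2)"
proof -
  have "norm (of_real 1 * (of_real (real (Suc n)) powr (- s) + of_real (real (Suc n) + 1) powr (- s)) / 2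
      - (power_primitive s (of_real (real (Suc n) + 1)) - power_primitive s (of_real (real (Suc n)))))
    \<le> (norm s * norm (s + 1) * real (Suc n) powr (- 3/2)) * 1 ^ 3 / 2"
  proof (rule trapezoid_error[where f' = "\<lambda>z. - s * z powr (- s - 1)"
        and f'' = "\<lambda>z. s * (s + 1) * z powr (- s - 2)"])
    fix t assume t: "t \<in> {real (Suc n)..real (Suc n) + 1}"
    then have t1: "t \<ge> 1" "t > 0" by auto
    then have nonpos: "complex_of_real t \<notin> \<real>\<^sub>\<le>\<^sub>0" by (simp add: complex_nonpos_Reals_iff)
    show "(power_primitive s has_field_derivative of_real t powr - s) (at (of_real t))"
      using nonpos by (rule power_primitive_deriv)
    show "((\<lambda>z. z powr - s) has_field_derivative - s * of_real t powr (- s - 1)) (at (of_real t))"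
      using nonpos by (auto intro!: derivative_eq_intros)
    show "((\<lambda>z. - s * z powr (- s - 1)) has_field_derivative s * (s + 1) * of_real t powr (- s - 2)) (at (of_real t))"
      using nonpos by (auto intro!: derivative_eq_intros simp: algebra_simps)
    have "norm (complex_of_real t powr (- s - 2)) = t powr (- Re s - 2)"
      using t1 by (subst norm_powr_real_powr) auto
    also have "\<dots> \<le> t powr (-3/2)" proof (rule powr_mono)
      have "3/2 \<le> Re s + 2" using assms by simp
      then show "- Re s - 2 \<le> -3/2" by simp
    qed (use t1 in simp)
    also have "\<dots> \<le> real (Suc n) powr (-3/2)" using t by (intro powr_mono2') auto
    finally show "norm (s * (s + 1) * of_real t powr (- s - 2)) \<le> norm s * norm (s + 1) * real (Suc n) powr (- 3/2)"
      unfolding norm_mult by (intro mult_left_mono) auto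
  qed simp
  also have "\<dots> \<le> norm s * norm (s + 1) * real (Suc n) powr (- 3/2)" by simp
  finally show ?thesis unfolding zeta_defect_def by (simp add: add_ac)
qed

lemma zeta_defect_summable:
  assumes "Re s \<ge> -1/2" shows "summable (\<lambda>n. zeta_defect n s)"
proof (rule summable_comparison_test')
  show "summable (\<lambda>n. norm s * norm (s + 1) * real (Suc n) powr (- 3/2))"
    by (intro summable_mult summable_Suc_powr) simp
qed (rule zeta_defect_bound[OF assms])

text \<open>
  The function \<open>\<zeta>(s) - 1/(s - 1)\<close>, continued to \<open>Re s > -1/2\<close> including \<open>s = 1\<close>: the term \<open>1/2\<close>
  is half of the first term of the zeta series.
\<close>
definition zeta_regular :: "complex \<Rightarrow> complex" where
  "zeta_regular s = 1/2 + (\<Sum>n. zeta_defect n s)"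

lemma zeta_regular_holomorphic: "zeta_regular holomorphic_on {s. Re s > -1/2}"
proof -
  have "(\<lambda>s. \<Sum>n. zeta_defect n s) holomorphic_on {s. Re s > -1/2}"
  proof (rule holomorphic_suminf)
    fix z :: complex assume "z \<in> {s. Re s > -1/2}"
    define C where "C = (norm z + 1) * (norm z + 2)"
    have "norm (zeta_defect n y) \<le> C * real (Suc n) powr (-3/2)"
      if "y \<in> ball z 1 \<inter> {s. Re s > -1/2}" for n y
    proof -
      have y: "norm y \<le> norm z + 1"
        using that norm_triangle_ineq2[of y z] by (simp add: dist_norm norm_minus_commute)
      then have "norm (y + 1) \<le> norm z + 2"
        using norm_triangle_ineq[of y 1] by simp
      with y have "norm y * norm (y + 1) \<le> C" unfolding C_def by (intro mult_mono) auto
      then have "norm y * norm (y + 1) * real (Suc n) powr (-3/2) \<le> C * real (Suc n) powr (-3/2)"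
        by (intro mult_right_mono) auto
      moreover have "Re y \<ge> -1/2" using that by simp
      ultimately show ?thesis using zeta_defect_bound[of y n] by linarith
    qed
    then show "\<exists>d h. 0 < d \<and> summable h \<and>
        (\<forall>n. \<forall>y\<in>ball z d \<inter> {s. Re s > -1/2}. norm (zeta_defect n y) \<le> h n)"
      by (intro exI[of _ 1] exI[of _ "\<lambda>n. C * real (Suc n) powr (-3/2)"])
         (auto intro!: summable_mult summable_Suc_powr simp del: of_nat_Suc)
  qed (auto simp: zeta_defect_holomorphic open_halfspace_Re_gt)
  then show ?thesis unfolding zeta_regular_def[abs_def] by (intro holomorphic_intros)
qed

lemma tendsto_nat_powr_0:
  assumes "Re s < 0" shows "(\<lambda>n. complex_of_nat (Suc n) powr s) \<longlonglongrightarrow> 0"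
proof -
  have "(\<lambda>n. real n powr Re s) \<longlonglongrightarrow> 0"
    by (rule tendsto_neg_powr[OF assms filterlim_real_sequentially])
  then have "(\<lambda>n. real (Suc n) powr Re s) \<longlonglongrightarrow> 0" by (rule LIMSEQ_Suc)
  moreover have "norm (complex_of_nat (Suc n) powr s) = real (Suc n) powr Re s" for n
    using norm_powr_real_powr[of "complex_of_nat (Suc n)" s] by simp
  ultimately show ?thesis by (intro tendsto_norm_zero_cancel[of "\<lambda>n. complex_of_nat (Suc n) powr s"]) simp
qed

lemma zeta_sums:
  assumes "Re s > 1"
  shows "(\<lambda>n. of_nat (Suc n) powr (- s)) sums (1 / (s - 1) + zeta_regular s)"
proof -
  have s1: "s \<noteq> 1" using assms by auto
  have "(\<lambda>n. complex_of_nat (Suc n) powr (- s)) \<longlonglongrightarrow> 0"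
    using assms by (intro tendsto_nat_powr_0) auto
  moreover have "(\<lambda>n. power_primitive s (of_nat (Suc n))) \<longlonglongrightarrow> (0 - 1) / (1 - s)"
    unfolding power_primitive_def if_not_P[OF s1] using s1 assms
    by (intro tendsto_divide tendsto_diff tendsto_nat_powr_0 tendsto_const) auto
  moreover have "(\<lambda>n. zeta_defect n s) sums (\<Sum>n. zeta_defect n s)"
    using assms by (intro summable_sums zeta_defect_summable) auto
  ultimately have "(\<lambda>n. of_nat (Suc n) powr (- s)) sums
      ((\<Sum>n. zeta_defect n s) + of_nat (Suc 0) powr (-s) / 2 + ((0 - 1) / (1 - s) - power_primitive s (of_nat (Suc 0))))"
    unfolding zeta_defect_def by (rule sums_trapezoid)
  also have "(\<Sum>n. zeta_defect n s) + of_nat (Suc 0) powr (-s) / 2 + ((0 - 1) / (1 - s) - power_primitive s (of_nat (Suc 0)))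
     = 1 / (s - 1) + zeta_regular s"
    using s1 by (simp add: zeta_regular_def power_primitive_def) (simp add: divide_simps)
  finally show ?thesis .
qed

text \<open>
  The trapezoid rule is exact for the constant function, so every error vanishes at \<open>s = 0\<close>.
\<close>
lemma zeta_regular_0: "zeta_regular 0 = 1/2"
proof -
  have "zeta_defect n 0 = 0" for n
  proof -
    have "complex_of_nat (Suc n) \<noteq> 0" "complex_of_nat (Suc (Suc n)) \<noteq> 0"
      by (rule of_nat_neq_0)+
    then show ?thesis unfolding zeta_defect_def power_primitive_def
      by (simp del: of_nat_Suc) simp
  qed
  then show ?thesis by (simp add: zeta_regular_def)
qed

section \<open>The digamma function and \<open>F\<^sub>1\<close>\<close>

text \<open>
  The error of the trapezoid rule for \<open>1/x\<close> on \<open>[z, z + 1]\<close>.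
\<close>
definition log_defect :: "complex \<Rightarrow> complex" where
  "log_defect z = (1 / z + 1 / (z + 1)) / 2 - (Ln (z + 1) - Ln z)"

lemma log_defect_bound:
  assumes "a > 0"
  shows "norm (log_defect (of_real a)) \<le> 1 / a ^ 3"
proof -
  have "norm (of_real 1 * (1 / of_real a + 1 / of_real (a + 1)) / 2
      - (Ln (of_real (a + 1)) - Ln (complex_of_real a))) \<le> (2 / a ^ 3) * 1 ^ 3 / 2"
  proof (rule trapezoid_error[where f = "\<lambda>z. 1 / z" and f' = "\<lambda>z. - 1 / z ^ 2" and f'' = "\<lambda>z. 2 / z ^ 3"])
    fix t assume t: "t \<in> {a..a + 1}"
    then have nz: "complex_of_real t \<noteq> 0" and nonpos: "complex_of_real t \<notin> \<real>\<^sub>\<le>\<^sub>0"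
      using assms by (auto simp: complex_nonpos_Reals_iff)
    show "(Ln has_field_derivative 1 / of_real t) (at (of_real t))"
      using has_field_derivative_Ln[OF nonpos] by (simp add: divide_inverse)
    show "((\<lambda>z. 1 / z) has_field_derivative - 1 / of_real t ^ 2) (at (complex_of_real t))"
      using nz by (auto intro!: derivative_eq_intros simp: power2_eq_square)
    show "((\<lambda>z. - 1 / z ^ 2) has_field_derivative 2 / of_real t ^ 3) (at (complex_of_real t))"
      using nz by (auto intro!: derivative_eq_intros simp: field_simps eval_nat_numeral)
    have "a ^ 3 \<le> t ^ 3" using t assms by (intro power_mono) auto
    then show "norm (2 / complex_of_real t ^ 3) \<le> 2 / a ^ 3"
      using t assms by (simp add: norm_divide norm_power frac_le)
  qed simp
  then show ?thesis unfolding log_defect_def by simp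
qed

definition digamma_defect :: "complex \<Rightarrow> complex" where
  "digamma_defect z = Digamma z + 1 / (2 * z) - Ln z"

text \<open>
  The partial sums of \<open>1/(z + q)\<close> produce the digamma function as the limit of
  \<open>log m - \<Sum>\<^sub>q\<^sub><\<^sub>m 1/(z + q)\<close>; the logarithms telescope and absorb \<open>log m\<close>.
\<close>
lemma log_defect_sums:
  assumes "z > 0"
  shows "(\<lambda>q. log_defect (of_real (z + real q))) sums (- digamma_defect (of_real z))"
proof -
  have eq: "(\<Sum>q<m. log_defect (of_real (z + real q)))
      = (\<Sum>q<m. inverse (of_real z + of_nat q)) + (inverse (of_real z + of_nat m) - inverse (of_real z)) / 2
        - (Ln (of_real (z + real m)) - Ln (of_real z))" for m
  proof (induction m)
    case (Suc m)
    have "log_defect (of_real (z + real m))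
        = (inverse (of_real z + of_nat m) + inverse (of_real z + of_nat (Suc m))) / 2
          - (Ln (of_real (z + real (Suc m))) - Ln (of_real (z + real m)))"
      by (simp add: log_defect_def inverse_eq_divide add_ac)
    then show ?case unfolding sum.lessThan_Suc Suc
      by (simp only:) (simp del: of_real_add of_nat_Suc add: add_divide_distrib diff_divide_distrib)
  qed simp
  have "(\<lambda>m. ln (1 + z * inverse (real m))) \<longlonglongrightarrow> ln (1 + z * 0)"
    by (intro tendsto_intros lim_inverse_n) auto
  moreover have "\<forall>\<^sub>F m in sequentially. ln (1 + z * inverse (real m)) = ln (z + real m) - ln (real m)"
    using eventually_gt_at_top[of 0]
  proof eventually_elim
    case (elim m)
    then have "1 + z * inverse (real m) = (z + real m) / real m" by (simp add: field_simps)
    with elim assms show ?case by (simp add: ln_div)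
  qed
  ultimately have "(\<lambda>m. ln (z + real m) - ln (real m)) \<longlonglongrightarrow> 0"
    by (simp add: tendsto_cong)
  then have A: "(\<lambda>m. complex_of_real (ln (z + real m) - ln (real m))) \<longlonglongrightarrow> of_real 0"
    by (rule tendsto_of_real)
  have B: "(\<lambda>m. of_real (ln (real m)) - (\<Sum>q<m. inverse (complex_of_real z + of_nat q))) \<longlonglongrightarrow> Digamma (of_real z)"
    by (rule Digamma_LIMSEQ) (use assms in auto)
  have "filterlim (\<lambda>m. z + real m) at_top sequentially"
    by (rule filterlim_tendsto_add_at_top[OF tendsto_const filterlim_real_sequentially])
  then have "(\<lambda>m. inverse (z + real m)) \<longlonglongrightarrow> 0"
    by (rule tendsto_inverse_0_at_top)
  then have C: "(\<lambda>m. complex_of_real (inverse (z + real m))) \<longlonglongrightarrow> of_real 0"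
    by (rule tendsto_of_real)
  have "(\<lambda>m. - (of_real (ln (real m)) - (\<Sum>q<m. inverse (complex_of_real z + of_nat q)))
       + (complex_of_real (inverse (z + real m)) - inverse (of_real z)) / 2
       - complex_of_real (ln (z + real m) - ln (real m)) + Ln (of_real z))
    \<longlonglongrightarrow> - Digamma (of_real z) + (of_real 0 - inverse (of_real z)) / 2 - of_real 0 + Ln (of_real z)"
    by (intro tendsto_intros A B C) simp
  moreover have "- (of_real (ln (real m)) - (\<Sum>q<m. inverse (complex_of_real z + of_nat q)))
       + (complex_of_real (inverse (z + real m)) - inverse (of_real z)) / 2
       - complex_of_real (ln (z + real m) - ln (real m)) + Ln (of_real z)
      = (\<Sum>q<m. log_defect (of_real (z + real q)))" for m
  proof -
    have "Ln (of_real (z + real m)) = of_real (ln (z + real m))"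
      using assms by (intro Ln_of_real) simp
    then show ?thesis unfolding eq by simp
  qed
  moreover have "- Digamma (of_real z) + (of_real 0 - inverse (of_real z)) / 2 - of_real 0 + Ln (of_real z)
      = - digamma_defect (of_real z)"
    by (simp add: digamma_defect_def inverse_eq_divide)
  ultimately show ?thesis unfolding sums_def by simp
qed

lemma zeta_regular_1: "zeta_regular 1 = euler_mascheroni"
proof -
  have "zeta_defect n 1 = log_defect (of_real (1 + real n))" for n
    unfolding zeta_defect_def log_defect_def power_primitive_def
    by (simp add: powr_minus inverse_eq_divide add_ac)
  then have "(\<lambda>n. zeta_defect n 1) sums (- digamma_defect 1)"
    using log_defect_sums[of 1] by simp
  then show ?thesis by (simp add: zeta_regular_def sums_iff digamma_defect_def)
qed

text \<open>
  Products \<open>lattice_weight n * lattice_weight q\<close> dominate every double series of trapezoid errors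
  below.  The exponent is what is left of \<open>\<surd>p / (p + q)\<^sup>3\<close> when \<open>5/2\<close> powers are shared equally
  between \<open>p\<close> and \<open>q + 1\<close>.
\<close>
definition lattice_weight :: "nat \<Rightarrow> real" where
  "lattice_weight n = real (Suc n) powr (- 5/4)"

lemma lattice_weight_nonneg: "lattice_weight n \<ge> 0"
  by (simp add: lattice_weight_def)

lemma lattice_weight_summable: "summable lattice_weight"
  unfolding lattice_weight_def[abs_def] by (rule summable_Suc_powr) simp

text \<open>
  Both \<open>n + 1\<close> and \<open>q + 1\<close> are at most \<open>N = n + 1 + q\<close>, and \<open>N\<^sup>3\<close> is the product of its powers
  with exponents \<open>7/4\<close> and \<open>5/4\<close>.
\<close>
lemma cubic_lattice_bound:
  "sqrt (real (Suc n)) / (real (Suc n) + real q) ^ 3 \<le> lattice_weight n * lattice_weight q"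
proof -
  define P where "P = real (Suc n)"
  define Q where "Q = real (Suc q)"
  define N where "N = real (Suc n) + real q"
  have pos: "P > 0" "Q > 0" "P \<le> N" "Q \<le> N" "N > 0" by (auto simp: P_def Q_def N_def)
  have "P powr (7/4) * Q powr (5/4) \<le> N powr (7/4) * N powr (5/4)"
    using pos by (intro mult_mono powr_mono2) auto
  also have "\<dots> = N ^ 3" using pos by (simp add: powr_add[symmetric])
  finally have "sqrt P / N ^ 3 \<le> sqrt P / (P powr (7/4) * Q powr (5/4))"
    using pos by (intro divide_left_mono mult_pos_pos) auto
  also have "\<dots> = P powr (1/2) * P powr (- (7/4)) * Q powr (- (5/4))"
    using pos by (simp add: powr_half_sqrt powr_minus_divide)
  also have "\<dots> = lattice_weight n * lattice_weight q"
    using pos by (simp add: powr_add[symmetric] lattice_weight_def P_def Q_def)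
  finally show ?thesis by (simp add: P_def N_def)
qed

lemma shifted_lattice_bound:
  fixes w :: real
  assumes "w > 0"
  shows "sqrt (real (Suc n)) / (real q + real (Suc n) * w) ^ 3
    \<le> (1 / min 1 w ^ 3) * (lattice_weight n * lattice_weight q)"
proof -
  define \<kappa> where "\<kappa> = min 1 w"
  have \<kappa>: "\<kappa> > 0" "\<kappa> \<le> 1" "\<kappa> \<le> w" using assms by (auto simp: \<kappa>_def)
  have "\<kappa> * (real (Suc n) + real q) \<le> real q + real (Suc n) * w"
    using mult_right_mono[OF \<kappa>(2) of_nat_0_le_iff, of q]
      mult_right_mono[OF \<kappa>(3) of_nat_0_le_iff, of "Suc n"]
    unfolding distrib_left mult.commute[of "real (Suc n)"] by linarith
  then have "(\<kappa> * (real (Suc n) + real q)) ^ 3 \<le> (real q + real (Suc n) * w) ^ 3"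
    using \<kappa> by (intro power_mono) auto
  then have "sqrt (real (Suc n)) / (real q + real (Suc n) * w) ^ 3
      \<le> sqrt (real (Suc n)) / (\<kappa> * (real (Suc n) + real q)) ^ 3"
  proof (rule divide_left_mono)
    have "0 < real (Suc n) + real q" "0 < real q + real (Suc n) * w"
      using assms by (auto intro!: add_pos_nonneg add_nonneg_pos)
    then show "0 < (real q + real (Suc n) * w) ^ 3 * (\<kappa> * (real (Suc n) + real q)) ^ 3"
      using \<kappa> by (intro mult_pos_pos zero_less_power)
  qed simp_all
  also have "\<dots> = (1 / \<kappa> ^ 3) * (sqrt (real (Suc n)) / (real (Suc n) + real q) ^ 3)"
    by (simp add: power_mult_distrib)
  also have "\<dots> \<le> (1 / \<kappa> ^ 3) * (lattice_weight n * lattice_weight q)"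
    using \<kappa> by (intro mult_left_mono cubic_lattice_bound) auto
  finally show ?thesis by (simp add: \<kappa>_def)
qed

lemma log_defect_lattice_bound:
  assumes "w > 0"
  shows "norm (log_defect (of_real (real (Suc n) * w + real q)))
    \<le> (1 / min 1 w ^ 3) * (lattice_weight n * lattice_weight q)"
proof -
  have pos: "real (Suc n) * w + real q > 0" using assms by (intro add_pos_nonneg mult_pos_pos) auto
  have "norm (log_defect (of_real (real (Suc n) * w + real q))) \<le> 1 / (real (Suc n) * w + real q) ^ 3"
    by (rule log_defect_bound[OF pos])
  also have "\<dots> \<le> sqrt (real (Suc n)) / (real q + real (Suc n) * w) ^ 3"
    using pos by (simp add: add.commute divide_right_mono)
  also have "\<dots> \<le> (1 / min 1 w ^ 3) * (lattice_weight n * lattice_weight q)"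
    by (rule shifted_lattice_bound[OF assms])
  finally show ?thesis .
qed

lemma digamma_defect_summable:
  assumes "w > 0"
  shows "summable (\<lambda>n. digamma_defect (of_real (real (Suc n) * w)))"
proof (rule summable_comparison_test')
  define C where "C = 1 / min 1 w ^ 3"
  show "summable (\<lambda>n. (C * (\<Sum>q. lattice_weight q)) * lattice_weight n)"
    by (intro summable_mult lattice_weight_summable)
  fix n :: nat
  have "(\<lambda>q. log_defect (of_real (real (Suc n) * w + real q))) sums
      (- digamma_defect (of_real (real (Suc n) * w)))"
    using assms by (intro log_defect_sums) simp
  then have "- digamma_defect (of_real (real (Suc n) * w))
      = (\<Sum>q. log_defect (of_real (real (Suc n) * w + real q)))" by (simp add: sums_iff)
  then have "norm (digamma_defect (of_real (real (Suc n) * w)))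
      = norm (\<Sum>q. log_defect (of_real (real (Suc n) * w + real q)))" by (metis norm_minus_cancel)
  also have "\<dots> \<le> (C * lattice_weight n) * suminf lattice_weight"
    by (rule suminf_norm_le[OF _ lattice_weight_summable])
       (use log_defect_lattice_bound[OF assms, of n] in \<open>simp add: C_def mult.assoc\<close>)
  finally show "norm (digamma_defect (of_real (real (Suc n) * w))) \<le> (C * (\<Sum>q. lattice_weight q)) * lattice_weight n"
    by (simp add: mult_ac)
qed

lemma F1_eq:
  "F1 (of_real x) = (\<Sum>n. digamma_defect (of_real (real (Suc n) * x)))
     - 1 / 2 * (euler_mascheroni - Ln (2 * of_real pi / of_real x))"
  unfolding F1_def digamma_defect_def Let_def by (simp only: mult.assoc of_real_mult of_real_of_nat_eq)

text \<open>
  The series for \<open>F1\<close> converge separately at \<open>x\<close> and at \<open>y\<close>, so they may be subtracted termwise;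
  in the elementary parts \<open>\<gamma>\<close> and \<open>2\<pi>\<close> cancel.
\<close>
lemma F1_diff:
  assumes "x > 0" "y > 0"
  shows "F1 (of_real x) - F1 (of_real y)
    = (\<Sum>n. digamma_defect (of_real (real (Suc n) * x)) - digamma_defect (of_real (real (Suc n) * y)))
      - of_real (ln (x / y)) / 2"
proof -
  have "Ln (2 * of_real pi / of_real t) = of_real (ln (2 * pi) - ln t)" if "t > 0" for t
  proof -
    have "Ln (2 * of_real pi / of_real t) = Ln (of_real (2 * pi / t))" by simp
    also have "\<dots> = of_real (ln (2 * pi / t))" using that by (intro Ln_of_real) simp
    also have "ln (2 * pi / t) = ln (2 * pi) - ln t" using that by (intro ln_divide_pos) auto
    finally show ?thesis .
  qed
  note Ln_2pi = this[OF assms(1)] this[OF assms(2)]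
  have ln_xy: "ln (x / y) = ln x - ln y" using assms by (intro ln_divide_pos) auto
  show ?thesis unfolding F1_eq Ln_2pi ln_xy
    using suminf_diff[OF digamma_defect_summable[OF assms(1)] digamma_defect_summable[OF assms(2)]] assms
    by (simp add: algebra_simps add_divide_distrib diff_divide_distrib)
qed

section \<open>The incomplete beta series\<close>

lemma norm_pochhammer_le:
  fixes s :: complex
  assumes "norm s \<le> S"
  shows "norm (pochhammer s k) \<le> pochhammer S k"
proof (induction k)
  case (Suc k)
  have "norm (s + of_nat k) \<le> S + real k"
    using norm_triangle_ineq[of s "of_nat k"] assms by simp
  moreover have "S \<ge> 0" using assms norm_ge_zero order_trans by blast
  ultimately show ?case unfolding pochhammer_Suc norm_mult
    by (intro mult_mono Suc.IH) (auto intro: pochhammer_nonneg order_trans[OF norm_ge_zero Suc.IH])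
qed simp

lemma binomial_sums:
  fixes x :: complex
  assumes "norm x < 1"
  shows "(\<lambda>k. pochhammer s k / fact k * x ^ k) sums (1 - x) powr (- s)"
proof -
  have "(\<lambda>k. (- s gchoose k) * (- x) ^ k) sums (1 + - x) powr (- s)"
    using assms by (intro gen_binomial_complex) simp
  moreover have "(- s gchoose k) * (- x) ^ k = pochhammer s k / fact k * x ^ k" for k
    unfolding gbinomial_pochhammer power_minus[of x] by (simp flip: power_mult_distrib)
  ultimately show ?thesis by simp
qed

lemma binomial_summable_real:
  fixes x :: real
  assumes "0 \<le> x" "x < 1"
  shows "summable (\<lambda>k. pochhammer S k / fact k * x ^ k)"
proof -
  have "(\<lambda>k. (- S gchoose k) * (- x) ^ k) sums (1 + - x) powr (- S)"
    using assms by (intro gen_binomial_real) simp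
  moreover have "(- S gchoose k) * (- x) ^ k = pochhammer S k / fact k * x ^ k" for k
    unfolding gbinomial_pochhammer power_minus[of x] by (simp flip: power_mult_distrib)
  ultimately show ?thesis by (simp add: sums_iff)
qed

definition beta_coeff :: "complex \<Rightarrow> nat \<Rightarrow> complex" where
  "beta_coeff s k = pochhammer s k / fact k / (2 * s - 1 + of_nat k)"

text \<open>
  The factor of the incomplete beta integral that is left when a power of \<open>x\<close> is split off:
  \<open>\<integral>\<^sub>0\<^sup>x t\<^sup>2\<^sup>s\<^sup>-\<^sup>2 (1 - t)\<^sup>-\<^sup>s dt = x\<^sup>2\<^sup>s\<^sup>-\<^sup>1 beta_series s x\<close>, by expanding \<open>(1 - t)\<^sup>-\<^sup>s\<close>.
\<close>
definition beta_series :: "complex \<Rightarrow> complex \<Rightarrow> complex" where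
  "beta_series s x = (\<Sum>k. beta_coeff s k * x ^ k)"

lemma beta_denom:
  assumes "Re s > 1/2"
  shows "norm (2 * s - 1 + of_nat k) \<ge> 2 * Re s - 1" "2 * s - 1 + of_nat k \<noteq> 0"
proof -
  have "2 * Re s - 1 \<le> Re (2 * s - 1 + of_nat k)" by simp
  also have "\<dots> \<le> norm (2 * s - 1 + of_nat k)" by (rule complex_Re_le_cmod)
  finally show 1: "norm (2 * s - 1 + of_nat k) \<ge> 2 * Re s - 1" .
  have "0 < 2 * Re s - 1" using assms by simp
  then have "0 < norm (2 * s - 1 + of_nat k)" using 1 by (rule less_le_trans)
  then show "2 * s - 1 + of_nat k \<noteq> 0" by simp
qed

lemma norm_beta_term_le:
  assumes "Re s \<ge> \<sigma>" "\<sigma> > 1/2" "norm s \<le> S"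
  shows "norm (beta_coeff s k * x ^ k) \<le> 1 / (2 * \<sigma> - 1) * (pochhammer S k / fact k * norm x ^ k)"
proof -
  have "norm (2 * s - 1 + of_nat k) \<ge> 2 * \<sigma> - 1"
    using beta_denom(1)[of s k] assms by linarith
  then have "norm (beta_coeff s k) \<le> (pochhammer S k / fact k) / (2 * \<sigma> - 1)"
    unfolding beta_coeff_def norm_divide using assms
    by (intro frac_le divide_right_mono norm_pochhammer_le)
       (auto intro!: divide_nonneg_nonneg order_trans[OF norm_ge_zero norm_pochhammer_le])
  then have "norm (beta_coeff s k) * norm x ^ k \<le> (pochhammer S k / fact k) / (2 * \<sigma> - 1) * norm x ^ k"
    by (intro mult_right_mono) auto
  then show ?thesis by (simp add: norm_mult norm_power mult_ac)
qed

lemma beta_summable: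
  assumes "Re s > 1/2" "norm x < 1"
  shows "summable (\<lambda>k. beta_coeff s k * x ^ k)"
proof (rule summable_comparison_test')
  show "summable (\<lambda>k. 1 / (2 * Re s - 1) * (pochhammer (norm s) k / fact k * norm x ^ k))"
    using assms by (intro summable_mult binomial_summable_real) auto
qed (use norm_beta_term_le[of "Re s" s] assms in auto)

text \<open>
  On a bounded set of \<open>s\<close> that stays to the right of \<open>1/2\<close>, the terms are dominated by those of the
  binomial series with \<open>s\<close> replaced by a bound for \<open>|s|\<close>.
\<close>
lemma beta_series_holomorphic:
  assumes "norm x < 1"
  shows "(\<lambda>s. beta_series s x) holomorphic_on {s. Re s > 1/2}"
  unfolding beta_series_def
proof (rule holomorphic_suminf)
  fix k show "(\<lambda>s. beta_coeff s k * x ^ k) holomorphic_on {s. Re s > 1/2}"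
    unfolding beta_coeff_def pochhammer_prod
    by (intro holomorphic_intros) (use beta_denom(2) in auto)
next
  fix z :: complex assume "z \<in> {s. Re s > 1/2}"
  then have z: "Re z > 1/2" by simp
  define d where "d = (Re z - 1/2) / 2"
  define \<sigma> where "\<sigma> = (Re z + 1/2) / 2"
  have d: "d > 0" "\<sigma> > 1/2" "\<sigma> = Re z - d" using z by (auto simp: d_def \<sigma>_def field_simps)
  have "norm (beta_coeff y k * x ^ k) \<le> 1 / (2 * \<sigma> - 1) * (pochhammer (norm z + d) k / fact k * norm x ^ k)"
    if "y \<in> ball z d \<inter> {s. Re s > 1/2}" for y k
  proof (rule norm_beta_term_le)
    have y: "norm (z - y) < d" using that by (simp add: dist_norm)
    then show "\<sigma> \<le> Re y" using complex_Re_le_cmod[of "z - y"] d by simp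
    show "norm y \<le> norm z + d" using y norm_triangle_ineq2[of y z] by (simp add: norm_minus_commute)
  qed (use d in auto)
  then show "\<exists>d h. 0 < d \<and> summable h \<and>
      (\<forall>k. \<forall>y\<in>ball z d \<inter> {s. Re s > 1/2}. norm (beta_coeff y k * x ^ k) \<le> h k)"
    using assms d(1)
    by (intro exI[of _ d] exI[of _ "\<lambda>k. 1 / (2 * \<sigma> - 1) * (pochhammer (norm z + d) k / fact k * norm x ^ k)"])
       (auto intro!: summable_mult binomial_summable_real simp del: times_divide_eq_left)
qed (rule open_halfspace_Re_gt)

text \<open>
  This is the derivative of the incomplete beta integral: multiplying the \<open>k\<close>-th term by
  \<open>2 s - 1 + k\<close> cancels the denominator and leaves the binomial series.
\<close>
lemma beta_series_deriv:
  assumes "Re s > 1/2" "norm x < 1"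
  obtains B' where "(beta_series s has_field_derivative B') (at x)"
    "(2 * s - 1) * beta_series s x + x * B' = (1 - x) powr (- s)"
proof -
  define B' where "B' = (\<Sum>k. diffs (beta_coeff s) k * x ^ k)"
  obtain K :: real where K: "norm x < K" "K < 1" using assms(2) dense by blast
  then have "norm x < norm (complex_of_real K)" "norm (complex_of_real K) < 1"
    using order.strict_trans1[OF norm_ge_zero K(1)] by auto
  then have "((\<lambda>x. \<Sum>k. beta_coeff s k * x ^ k) has_field_derivative B') (at x)"
    unfolding B'_def by (intro termdiffs_strong beta_summable[OF assms(1)])
  then have d: "(beta_series s has_field_derivative B') (at x)"
    by (simp add: beta_series_def[abs_def])
  have "summable (\<lambda>k. diffs (beta_coeff s) k * x ^ k)"
    by (rule termdiff_converges[OF assms(2)]) (use beta_summable[OF assms(1)] in auto)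
  then have "(\<lambda>k. of_nat k * beta_coeff s k * x ^ (k - Suc 0)) sums B'"
    unfolding B'_def by (rule diffs_equiv)
  then have "(\<lambda>k. x * (of_nat k * beta_coeff s k * x ^ (k - Suc 0))) sums (x * B')"
    by (rule sums_mult)
  moreover have "x * (of_nat k * beta_coeff s k * x ^ (k - Suc 0)) = of_nat k * beta_coeff s k * x ^ k" for k
    by (cases k) auto
  ultimately have 1: "(\<lambda>k. of_nat k * beta_coeff s k * x ^ k) sums (x * B')" by simp
  have 2: "(\<lambda>k. (2 * s - 1) * (beta_coeff s k * x ^ k)) sums ((2 * s - 1) * beta_series s x)"
    unfolding beta_series_def by (intro sums_mult summable_sums beta_summable assms)
  have "(2 * s - 1) * (beta_coeff s k * x ^ k) + of_nat k * beta_coeff s k * x ^ k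
      = pochhammer s k / fact k * x ^ k" for k
  proof -
    have "(2 * s - 1) * (beta_coeff s k * x ^ k) + of_nat k * beta_coeff s k * x ^ k
      = (2 * s - 1 + of_nat k) * beta_coeff s k * x ^ k" by (simp add: algebra_simps)
    also have "(2 * s - 1 + of_nat k) * beta_coeff s k = pochhammer s k / fact k"
      unfolding beta_coeff_def using beta_denom(2)[OF assms(1), of k] by simp
    finally show ?thesis .
  qed
  with sums_add[OF 2 1] have "(\<lambda>k. pochhammer s k / fact k * x ^ k) sums ((2 * s - 1) * beta_series s x + x * B')"
    by simp
  then have "(2 * s - 1) * beta_series s x + x * B' = (1 - x) powr (- s)"
    using binomial_sums[OF assms(2)] sums_unique2 by blast
  with d show ?thesis by (rule that)
qed

lemma beta_series_1:
  assumes "norm x < 1"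
  shows "x * beta_series 1 x = - Ln (1 - x)"
proof -
  have "(\<lambda>n. - ((- (- x)) ^ n) / of_nat n) sums Ln (1 + - x)"
    using assms by (intro Ln_series') simp
  then have "(\<lambda>n. - (x ^ Suc n) / of_nat (Suc n)) sums Ln (1 - x)"
    by (subst sums_Suc_iff) simp
  then have "(\<lambda>n. x ^ Suc n / of_nat (Suc n)) sums (- Ln (1 - x))"
    using sums_minus by fastforce
  moreover have "x ^ Suc n / of_nat (Suc n) = x * (beta_coeff 1 n * x ^ n)" for n
    unfolding beta_coeff_def by (simp add: pochhammer_fact[symmetric] add_ac)
  ultimately have "(\<lambda>n. x * (beta_coeff 1 n * x ^ n)) sums (- Ln (1 - x))" by simp
  moreover have "(\<lambda>n. x * (beta_coeff 1 n * x ^ n)) sums (x * beta_series 1 x)"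
    unfolding beta_series_def using assms by (intro sums_mult summable_sums beta_summable) auto
  ultimately show ?thesis by (rule sums_unique2[symmetric])
qed

text \<open>
  All terms are nonnegative at \<open>s = 2\<close>, and the first is positive.
\<close>
lemma beta_series_2_nonzero:
  assumes "0 \<le> x" "x < 1"
  shows "beta_series 2 (of_real x) \<noteq> 0"
proof -
  define b where "b k = pochhammer 2 k / fact k / (3 + real k) * x ^ k" for k
  have "pochhammer (2::complex) k = of_real (pochhammer 2 k)" for k
    using pochhammer_of_real[of "2::real" k, where 'a=complex] by simp
  then have b: "beta_coeff 2 k * of_real x ^ k = of_real (b k)" for k
    unfolding beta_coeff_def b_def by simp
  have "summable (\<lambda>k. complex_of_real (b k))"
    using beta_summable[of 2 "of_real x"] assms by (simp add: b)
  then have s: "summable b" by (simp add: summable_of_real_iff)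
  have "b k \<ge> 0" for k
    unfolding b_def using assms by (intro mult_nonneg_nonneg divide_nonneg_nonneg pochhammer_nonneg) auto
  moreover have "b 0 > 0" by (simp add: b_def)
  ultimately have "suminf b > 0" using s by (intro suminf_pos2)
  moreover have "beta_series 2 (of_real x) = of_real (suminf b)"
    unfolding beta_series_def b by (rule suminf_of_real[OF s, symmetric])
  ultimately show ?thesis by simp
qed

section \<open>The form on the half-line and its tail integral\<close>

locale root_pair =
  fixes w w' :: real
  assumes w'_pos: "0 < w'" and w'_less: "w' < w"
begin

definition \<Delta> :: real where "\<Delta> = w - w'"

lemma \<Delta>_pos: "\<Delta> > 0" and w_pos: "w > 0"
  using w'_pos w'_less by (auto simp: \<Delta>_def)

text \<open>
  For real \<open>u \<ge> 0\<close> this is \<open>(\<Delta> / ((u + w) (u + w')))\<^sup>s\<close> (\<open>h_of_real\<close>).  Writing it with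
  separate logarithms makes it holomorphic near the half-line, so that complex derivatives
  are available.
\<close>
definition h :: "complex \<Rightarrow> complex \<Rightarrow> complex" where
  "h s u = exp (s * (of_real (ln \<Delta>) - Ln (u + of_real w) - Ln (u + of_real w')))"

definition h' :: "complex \<Rightarrow> complex \<Rightarrow> complex" where
  "h' s u = - s * (1 / (u + of_real w) + 1 / (u + of_real w')) * h s u"

definition h'' :: "complex \<Rightarrow> complex \<Rightarrow> complex" where
  "h'' s u = (s\<^sup>2 * (1 / (u + of_real w) + 1 / (u + of_real w'))\<^sup>2
     + s * (1 / (u + of_real w)\<^sup>2 + 1 / (u + of_real w')\<^sup>2)) * h s u"

lemma shifts_slit:
  assumes "u \<ge> 0"
  shows "of_real u + of_real w \<notin> (\<real>\<^sub>\<le>\<^sub>0 :: complex set)" "of_real u + of_real w' \<notin> (\<real>\<^sub>\<le>\<^sub>0 :: complex set)"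
    "of_real u + of_real w \<noteq> (0::complex)" "of_real u + of_real w' \<noteq> (0::complex)"
  using assms w_pos w'_pos by (auto simp: complex_nonpos_Reals_iff simp flip: of_real_add)

lemma h_deriv:
  assumes "u \<ge> 0"
  shows "(h s has_field_derivative h' s (of_real u)) (at (of_real u))"
  unfolding h_def[abs_def] h'_def using shifts_slit[OF assms]
  by (auto intro!: derivative_eq_intros simp: h_def inverse_eq_divide algebra_simps)

lemma h'_deriv:
  assumes "u \<ge> 0"
  shows "(h' s has_field_derivative h'' s (of_real u)) (at (of_real u))"
proof -
  let ?a = "complex_of_real u + of_real w" and ?b = "complex_of_real u + of_real w'"
  have d: "((\<lambda>z::complex. 1 / (z + of_real c)) has_field_derivative - 1 / (of_real u + of_real c)\<^sup>2) (at (of_real u))"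
    if "of_real u + of_real c \<noteq> (0::complex)" for c
    using that by (auto intro!: derivative_eq_intros simp: power2_eq_square)
  have "((\<lambda>z. (- s * (1 / (z + of_real w) + 1 / (z + of_real w'))) * h s z) has_field_derivative
     (- s * (1 / ?a + 1 / ?b)) * h' s (of_real u) + (- s * (- 1 / ?a\<^sup>2 + - 1 / ?b\<^sup>2)) * h s (of_real u)) (at (of_real u))"
    by (intro DERIV_mult' DERIV_cmult DERIV_add d h_deriv assms shifts_slit)
  moreover have "(- s * (1 / ?a + 1 / ?b)) * h' s (of_real u) + (- s * (- 1 / ?a\<^sup>2 + - 1 / ?b\<^sup>2)) * h s (of_real u) = h'' s (of_real u)"
    unfolding h'_def h''_def by (simp add: algebra_simps power2_eq_square)
  ultimately show ?thesis unfolding h'_def[abs_def] by simp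
qed

lemma h_of_real:
  assumes "u \<ge> 0"
  shows "h s (of_real u) = of_real (\<Delta> / ((u + w) * (u + w'))) powr s"
proof -
  have pos: "u + w > 0" "u + w' > 0" using assms w_pos w'_pos by auto
  have "Ln (of_real (\<Delta> / ((u + w) * (u + w')))) = of_real (ln (\<Delta> / ((u + w) * (u + w'))))"
    using pos \<Delta>_pos by (intro Ln_of_real) simp
  also have "ln (\<Delta> / ((u + w) * (u + w'))) = ln \<Delta> - ln (u + w) - ln (u + w')"
    using pos \<Delta>_pos by (simp add: ln_div ln_mult)
  finally show ?thesis
    using \<Delta>_pos Ln_of_real[OF pos(1)] Ln_of_real[OF pos(2)] shifts_slit[OF assms]
    by (simp add: h_def powr_def)
qed

lemma h_1: "u \<ge> 0 \<Longrightarrow> h 1 (of_real u) = of_real (\<Delta> / ((u + w) * (u + w')))"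
  using h_of_real[of u 1] by simp

text \<open>
  The integral \<open>\<integral>\<^sub>u\<^sup>\<infinity> h(v) dv\<close>: the substitution \<open>t = \<Delta>/(v + w)\<close>, under which
  \<open>1 - t = (v + w')/(v + w)\<close>, turns it into \<open>\<Delta>\<^sup>1\<^sup>-\<^sup>s \<integral>\<^sub>0\<^sup>x t\<^sup>2\<^sup>s\<^sup>-\<^sup>2 (1 - t)\<^sup>-\<^sup>s dt\<close> with
  \<open>x = \<Delta>/(u + w) < 1\<close>.
\<close>
definition tail :: "complex \<Rightarrow> complex \<Rightarrow> complex" where
  "tail s u = of_real \<Delta> powr (1 - s) * (of_real \<Delta> / (u + of_real w)) powr (2 * s - 1)
     * beta_series s (of_real \<Delta> / (u + of_real w))"

lemma tail_argument:
  assumes "u \<ge> 0"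
  shows "0 < \<Delta> / (u + w)" "\<Delta> / (u + w) < 1" "1 - \<Delta> / (u + w) = (u + w') / (u + w)"
    "norm (of_real \<Delta> / (of_real u + of_real w) :: complex) < 1"
proof -
  show 1: "0 < \<Delta> / (u + w)" "\<Delta> / (u + w) < 1" "1 - \<Delta> / (u + w) = (u + w') / (u + w)"
    using assms w_pos w'_pos w'_less by (auto simp: \<Delta>_def field_simps)
  have "norm (of_real \<Delta> / (of_real u + of_real w) :: complex) = \<bar>\<Delta> / (u + w)\<bar>"
    by (simp only: of_real_add[symmetric] of_real_divide[symmetric] norm_of_real)
  also have "\<dots> = \<Delta> / (u + w)" using 1(1) by (rule abs_of_pos)
  also note 1(2)
  finally show "norm (of_real \<Delta> / (of_real u + of_real w) :: complex) < 1" .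
qed

text \<open>
  The differential equation of the beta series reduces the derivative to a product of powers; on the
  half-line all bases are positive, so the exponents may be compared.
\<close>
lemma tail_deriv:
  assumes "Re s > 1/2" "u \<ge> 0"
  shows "(tail s has_field_derivative - h s (of_real u)) (at (of_real u))"
proof -
  define a where "a = complex_of_real u + of_real w"
  define X where "X = of_real \<Delta> / a"
  have a: "a \<noteq> 0" using shifts_slit[OF assms(2)] by (simp add: a_def)
  have X_real: "X = of_real (\<Delta> / (u + w))" by (simp add: X_def a_def)
  have X: "X \<noteq> 0" "X \<notin> \<real>\<^sub>\<le>\<^sub>0" using tail_argument(1)[OF assms(2)]
    unfolding X_real complex_nonpos_Reals_iff of_real_eq_0_iff Re_complex_of_real by auto
  have normX: "norm X < 1" using tail_argument(4)[OF assms(2)] by (simp add: X_def a_def)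
  obtain B' where B': "(beta_series s has_field_derivative B') (at X)"
    "(2 * s - 1) * beta_series s X + X * B' = (1 - X) powr (- s)"
    using beta_series_deriv[OF assms(1) normX] .
  define X' where "X' = - of_real \<Delta> / a\<^sup>2"
  have dX: "((\<lambda>z. of_real \<Delta> / (z + of_real w)) has_field_derivative X') (at (of_real u))"
    using a unfolding X'_def a_def by (auto intro!: derivative_eq_intros simp: power2_eq_square)
  have dX_powr: "((\<lambda>x. x powr (2 * s - 1)) has_field_derivative (2 * s - 1) * X powr (2 * s - 1 - 1)) (at X)"
    by (rule has_field_derivative_powr[OF X(2)])
  have "((\<lambda>x. x powr (2 * s - 1) * beta_series s x) has_field_derivative
      X powr (2 * s - 1) * B' + (2 * s - 1) * X powr (2 * s - 1 - 1) * beta_series s X) (at X)"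
    by (intro DERIV_mult' dX_powr B'(1))
  from DERIV_cmult[OF DERIV_chain2[OF this[unfolded X_def a_def] dX], of "of_real \<Delta> powr (1 - s)"]
  have "(tail s has_field_derivative of_real \<Delta> powr (1 - s) *
      ((X powr (2 * s - 1) * B' + (2 * s - 1) * X powr (2 * s - 1 - 1) * beta_series s X) * X')) (at (of_real u))"
    unfolding tail_def[abs_def] X_def a_def by (simp only: mult.assoc)
  also have "of_real \<Delta> powr (1 - s) *
      ((X powr (2 * s - 1) * B' + (2 * s - 1) * X powr (2 * s - 1 - 1) * beta_series s X) * X')
      = of_real \<Delta> powr (1 - s) * X powr (2 * s - 2) * X' * (1 - X) powr (- s)"
  proof -
    have e: "X powr (2 * s - 1) = X powr (2 * s - 2) * X"
      using X(1) powr_add[of X "2 * s - 2" 1] by simp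
    have e2: "2 * s - 1 - 1 = 2 * s - 2" by simp
    show ?thesis unfolding e e2 B'(2)[symmetric] by (simp add: algebra_simps)
  qed
  also have "\<dots> = - h s (of_real u)"
  proof -
    have pos: "u + w > 0" "u + w' > 0" using assms w_pos w'_pos by auto
    define d l l' where "d = complex_of_real (ln \<Delta>)" and "l = complex_of_real (ln (u + w))"
      and "l' = complex_of_real (ln (u + w'))"
    have 1: "of_real \<Delta> powr (1 - s) = exp ((1 - s) * d)"
      using \<Delta>_pos by (simp add: powr_def d_def Ln_of_real)
    have "Ln X = of_real (ln (\<Delta> / (u + w)))" unfolding X_real
      using tail_argument(1)[OF assms(2)] by (rule Ln_of_real)
    also have "\<dots> = d - l" using pos \<Delta>_pos by (simp add: ln_div d_def l_def)
    finally have 2: "X powr (2 * s - 2) = exp ((2 * s - 2) * (d - l))"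
      using X(1) by (simp add: powr_def)
    have "a = exp l" unfolding a_def l_def using pos
      by (simp add: exp_of_real flip: of_real_add)
    moreover have "of_real \<Delta> = exp d" unfolding d_def using \<Delta>_pos by (simp add: exp_of_real)
    ultimately have 3: "X' = - exp (d - 2 * l)"
      unfolding X'_def by (simp add: exp_diff exp_double)
    have 4: "1 - X = of_real ((u + w') / (u + w))"
      unfolding X_real tail_argument(3)[OF assms(2), symmetric] by (simp only: of_real_diff of_real_1)
    have "Ln (1 - X) = of_real (ln ((u + w') / (u + w)))" unfolding 4
      using pos by (intro Ln_of_real) simp
    also have "\<dots> = l' - l" using pos by (simp add: ln_div l_def l'_def)
    finally have 5: "(1 - X) powr (- s) = exp (- s * (l' - l))"
      using shifts_slit[OF assms(2)] unfolding 4 by (simp add: powr_def)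
    have "Ln (of_real u + of_real w) = l" "Ln (of_real u + of_real w') = l'"
      using Ln_of_real[OF pos(1)] Ln_of_real[OF pos(2)] by (simp_all add: l_def l'_def)
    then have 6: "h s (of_real u) = exp (s * (d - l - l'))"
      by (simp add: h_def d_def)
    have "(1 - s) * d + (2 * s - 2) * (d - l) + (d - 2 * l) + (- s * (l' - l)) = s * (d - l - l')"
      by (simp add: algebra_simps)
    then have "exp ((1 - s) * d) * exp ((2 * s - 2) * (d - l)) * exp (d - 2 * l) * exp (- s * (l' - l))
        = exp (s * (d - l - l'))" by (simp only: exp_add[symmetric])
    then show ?thesis unfolding 1 2 3 5 6 by simp
  qed
  finally show ?thesis .
qed

lemma tail_holomorphic:
  assumes "u \<ge> 0"
  shows "(\<lambda>s. tail s (of_real u)) holomorphic_on {s. Re s > 1/2}"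
  unfolding tail_def
  by (intro holomorphic_intros beta_series_holomorphic tail_argument(4) assms)
     (use \<Delta>_pos shifts_slit[OF assms] in auto)

lemma tail_tendsto_0:
  assumes "Re s > 1/2" "filterlim f at_top sequentially"
  shows "(\<lambda>q. tail s (of_real (f q))) \<longlonglongrightarrow> 0"
proof -
  have "filterlim (\<lambda>q. w + f q) at_top sequentially"
    by (rule filterlim_tendsto_add_at_top[OF tendsto_const assms(2)])
  then have "filterlim (\<lambda>q. f q + w) at_top sequentially" by (simp only: add.commute)
  then have "(\<lambda>q. \<Delta> / (f q + w)) \<longlonglongrightarrow> 0"
    by (intro tendsto_divide_0[OF tendsto_const] filterlim_at_top_imp_at_infinity)
  then have "(\<lambda>q. complex_of_real (\<Delta> / (f q + w))) \<longlonglongrightarrow> of_real 0" by (rule tendsto_of_real)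
  then have X: "(\<lambda>q. of_real \<Delta> / (of_real (f q) + of_real w)) \<longlonglongrightarrow> (0::complex)" by simp
  obtain B' where "(beta_series s has_field_derivative B') (at 0)"
    using beta_series_deriv[OF assms(1), of 0] by auto
  then have "isCont (beta_series s) 0" by (rule DERIV_isCont)
  then have B: "(\<lambda>q. beta_series s (of_real \<Delta> / (of_real (f q) + of_real w))) \<longlonglongrightarrow> beta_series s 0"
    by (rule isCont_tendsto_compose[OF _ X])
  have "(\<lambda>q. (of_real \<Delta> / (of_real (f q) + of_real w)) powr (2 * s - 1)) \<longlonglongrightarrow> (0::complex)"
    using X by (rule tendsto_powr_complex_0) (use assms in auto)
  from tendsto_mult[OF tendsto_mult[OF tendsto_const this] B]
  show ?thesis unfolding tail_def by simp
qed

lemma tail_1: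
  assumes "u \<ge> 0"
  shows "tail 1 (of_real u) = of_real (ln (u + w) - ln (u + w'))"
proof -
  define X where "X = complex_of_real \<Delta> / (of_real u + of_real w)"
  have pos: "u + w > 0" "u + w' > 0" using assms w_pos w'_pos by auto
  have "X \<noteq> 0" using \<Delta>_pos shifts_slit[OF assms] by (simp add: X_def)
  then have "tail 1 (of_real u) = X * beta_series 1 X" using \<Delta>_pos by (simp add: tail_def X_def)
  also have "\<dots> = - Ln (1 - X)" using tail_argument(4)[OF assms] by (intro beta_series_1) (simp add: X_def)
  also have "1 - X = of_real ((u + w') / (u + w))"
    unfolding X_def tail_argument(3)[OF assms, symmetric] by simp
  also have "Ln \<dots> = of_real (ln ((u + w') / (u + w)))" using pos by (intro Ln_of_real) simp
  also have "ln ((u + w') / (u + w)) = ln (u + w') - ln (u + w)" using pos by (simp add: ln_div)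
  finally show ?thesis by simp
qed

lemma tail_2_nonzero: "tail 2 0 \<noteq> 0"
  using beta_series_2_nonzero[of "\<Delta> / w"] tail_argument(1,2)[of 0] \<Delta>_pos w_pos
  by (simp add: tail_def)

section \<open>Trapezoid errors of the rows\<close>

text \<open>
  The base \<open>y\<close> of the power is at most \<open>\<Delta>/(w w')\<close>.  For \<open>Re s \<ge> 1/2\<close> one keeps \<open>\<surd>y\<close>, which
  decays like \<open>1/u\<close>, and bounds the remaining power of \<open>y\<close> by a constant; thus the decay rate does
  not depend on \<open>s\<close>.
\<close>
lemma norm_h_le:
  assumes "u \<ge> 0" "Re s \<ge> 1/2" "norm s \<le> S"
  shows "norm (h s (of_real u)) \<le> (1 + \<Delta> / (w * w')) powr S * sqrt \<Delta> / (u + w')"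
proof -
  define y where "y = \<Delta> / ((u + w) * (u + w'))"
  have pos: "u + w > 0" "u + w' > 0" using assms w_pos w'_pos by auto
  have y: "y > 0" using pos \<Delta>_pos by (simp add: y_def)
  have "w * w' \<le> (u + w) * (u + w')" using assms w_pos w'_pos by (intro mult_mono) auto
  then have "y \<le> \<Delta> / (w * w')"
    unfolding y_def using \<Delta>_pos w_pos w'_pos pos by (intro divide_left_mono) auto
  then have y_le: "y \<le> 1 + \<Delta> / (w * w')" by simp
  have S: "Re s \<le> S" using assms complex_Re_le_cmod[of s] by linarith
  have "norm (h s (of_real u)) = y powr Re s"
    unfolding h_of_real[OF assms(1)] y_def[symmetric] using y by (subst norm_powr_real_powr) auto
  also have "\<dots> = y powr (1/2) * y powr (Re s - 1/2)" by (simp add: powr_add[symmetric])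
  also have "\<dots> \<le> sqrt \<Delta> / (u + w') * (1 + \<Delta> / (w * w')) powr S"
  proof (intro mult_mono)
    have "(u + w') * (u + w') \<le> (u + w) * (u + w')" using pos w'_less by (intro mult_right_mono) auto
    then have "y \<le> \<Delta> / (u + w')\<^sup>2"
      unfolding y_def power2_eq_square using \<Delta>_pos pos by (intro divide_left_mono) auto
    then have "sqrt y \<le> sqrt (\<Delta> / (u + w')\<^sup>2)" by simp
    then show "y powr (1/2) \<le> sqrt \<Delta> / (u + w')"
      using y pos by (simp add: powr_half_sqrt real_sqrt_divide)
    have "y powr (Re s - 1/2) \<le> (1 + \<Delta> / (w * w')) powr (Re s - 1/2)"
      using y y_le assms by (intro powr_mono2) auto
    also have "\<dots> \<le> (1 + \<Delta> / (w * w')) powr S"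
      using S \<Delta>_pos w_pos w'_pos by (intro powr_mono) auto
    finally show "y powr (Re s - 1/2) \<le> (1 + \<Delta> / (w * w')) powr S" .
  qed (use \<Delta>_pos pos in auto)
  finally show ?thesis by (simp add: mult.commute)
qed

definition h''_const :: "real \<Rightarrow> real" where
  "h''_const S = (4 * S\<^sup>2 + 2 * S) * ((1 + \<Delta> / (w * w')) powr S * sqrt \<Delta>)"

text \<open>
  Two derivatives gain \<open>(u + w')\<^sup>-\<^sup>2\<close> over \<open>h\<close>, because \<open>w > w'\<close>.
\<close>
lemma norm_h''_le:
  assumes "u \<ge> 0" "Re s \<ge> 1/2" "norm s \<le> S"
  shows "norm (h'' s (of_real u)) \<le> h''_const S / (u + w') ^ 3"
proof -
  have pos: "u + w > 0" "u + w' > 0" using assms w_pos w'_pos by auto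
  define b where "b = 1 / (u + w')"
  define H where "H = (1 + \<Delta> / (w * w')) powr S * sqrt \<Delta>"
  have S0: "S \<ge> 0" using assms(3) norm_ge_zero order_trans by blast
  have n: "norm (1 / (complex_of_real u + of_real w)) \<le> b" "norm (1 / (complex_of_real u + of_real w')) \<le> b"
    using pos w'_less by (auto simp: b_def norm_divide frac_le simp flip: of_real_add)
  then have n2: "norm (1 / (complex_of_real u + of_real w)\<^sup>2) \<le> b\<^sup>2" "norm (1 / (complex_of_real u + of_real w')\<^sup>2) \<le> b\<^sup>2"
    using power_mono[OF n(1), of 2] power_mono[OF n(2), of 2] by (simp_all add: norm_divide norm_power power_divide)
  have "norm (1 / (complex_of_real u + of_real w) + 1 / (complex_of_real u + of_real w')) \<le> 2 * b"
    using norm_triangle_le[OF add_mono[OF n]] by simp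
  then have A: "norm (s\<^sup>2 * (1 / (complex_of_real u + of_real w) + 1 / (complex_of_real u + of_real w'))\<^sup>2) \<le> S\<^sup>2 * (2 * b)\<^sup>2"
    unfolding norm_mult norm_power using assms(3) by (intro mult_mono power_mono) auto
  have "norm (1 / (complex_of_real u + of_real w)\<^sup>2 + 1 / (complex_of_real u + of_real w')\<^sup>2) \<le> 2 * b\<^sup>2"
    using norm_triangle_le[OF add_mono[OF n2]] by simp
  then have B: "norm (s * (1 / (complex_of_real u + of_real w)\<^sup>2 + 1 / (complex_of_real u + of_real w')\<^sup>2)) \<le> S * (2 * b\<^sup>2)"
    unfolding norm_mult using assms(3) S0 by (intro mult_mono) auto
  have "norm (h'' s (of_real u)) \<le> (S\<^sup>2 * (2 * b)\<^sup>2 + S * (2 * b\<^sup>2)) * (H * b)"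
    unfolding h''_def norm_mult
    using norm_triangle_le[OF add_mono[OF A B]] norm_h_le[OF assms] S0
    by (intro mult_mono) (auto simp: H_def b_def)
  also have "\<dots> = h''_const S / (u + w') ^ 3"
    unfolding h''_const_def H_def[symmetric] b_def by (simp add: power_divide power2_eq_square power3_eq_cube algebra_simps add_divide_distrib)
  finally show ?thesis .
qed

text \<open>
  The error of the trapezoid rule for \<open>x \<mapsto> p\<^sup>-\<^sup>s h(x/p)\<close> on \<open>[q, q + 1]\<close>, where \<open>p = n + 1\<close>,
  written on the scaled interval \<open>[q/p, (q + 1)/p]\<close> of length \<open>1/p\<close>.
\<close>
definition trapezoid_defect :: "nat \<Rightarrow> nat \<Rightarrow> complex \<Rightarrow> complex" where
  "trapezoid_defect n q s = of_nat (Suc n) powr (1 - s) *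
     (of_real (1 / real (Suc n)) * (h s (of_real (real q / real (Suc n))) + h s (of_real (real (Suc q) / real (Suc n)))) / 2
      - (tail s (of_real (real q / real (Suc n))) - tail s (of_real (real (Suc q) / real (Suc n)))))"

lemma trapezoid_defect_holomorphic: "trapezoid_defect n q holomorphic_on {s. Re s > 1/2}"
  unfolding trapezoid_defect_def[abs_def] h_def
  by (intro holomorphic_intros tail_holomorphic) (auto simp del: of_nat_Suc)

definition trapezoid_defect_bound :: "real \<Rightarrow> real" where
  "trapezoid_defect_bound S = h''_const S * (1 / min 1 w' ^ 3)"

text \<open>
  The step \<open>1/p\<close> enters the trapezoid bound cubed, which clears the denominators of
  \<open>(q/p + w')\<^sup>3\<close>; the prefactor \<open>p\<^sup>1\<^sup>-\<^sup>s\<close> contributes at most \<open>\<surd>p\<close>.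
\<close>
lemma norm_trapezoid_defect_le:
  assumes "Re s > 1/2" "norm s \<le> S"
  shows "norm (trapezoid_defect n q s) \<le> trapezoid_defect_bound S * (lattice_weight n * lattice_weight q)"
proof -
  define P where "P = real (Suc n)"
  define a where "a = real q / P"
  have P: "P \<ge> 1" by (simp add: P_def)
  have a: "a \<ge> 0" "a + 1 / P = real (Suc q) / P" using P by (auto simp: a_def add_divide_distrib)
  have S0: "S \<ge> 0" using assms(2) norm_ge_zero order_trans by blast
  have C0: "h''_const S \<ge> 0" unfolding h''_const_def using S0 \<Delta>_pos by simp
  have "norm (of_real (1 / P) * (h s (of_real a) + h s (of_real (a + 1 / P))) / 2
      - (- tail s (of_real (a + 1 / P)) - - tail s (of_real a)))
     \<le> h''_const S / (a + w') ^ 3 * (1 / P) ^ 3 / 2"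
  proof (rule trapezoid_error[where f' = "h' s" and f'' = "h'' s" and F = "\<lambda>u. - tail s u"])
    fix t assume t: "t \<in> {a..a + 1 / P}"
    then have t0: "t \<ge> 0" using a by simp
    show "((\<lambda>u. - tail s u) has_field_derivative h s (of_real t)) (at (of_real t))"
      using DERIV_minus[OF tail_deriv[OF assms(1) t0]] by simp
    show "(h s has_field_derivative h' s (of_real t)) (at (of_real t))" by (rule h_deriv[OF t0])
    show "(h' s has_field_derivative h'' s (of_real t)) (at (of_real t))" by (rule h'_deriv[OF t0])
    have "norm (h'' s (of_real t)) \<le> h''_const S / (t + w') ^ 3"
      using assms t0 by (intro norm_h''_le) auto
    also have "\<dots> \<le> h''_const S / (a + w') ^ 3"
      using t a w'_pos C0 by (intro divide_left_mono power_mono mult_pos_pos zero_less_power) auto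
    finally show "norm (h'' s (of_real t)) \<le> h''_const S / (a + w') ^ 3" .
  qed (use P in auto)
  also have "\<dots> \<le> h''_const S / (a + w') ^ 3 * (1 / P) ^ 3"
  proof -
    have "0 \<le> h''_const S / (a + w') ^ 3 * (1 / P) ^ 3" using C0 a(1) P w'_pos by simp
    moreover have "x / 2 \<le> x" if "x \<ge> 0" for x :: real using that by simp
    ultimately show ?thesis by blast
  qed
  also have "\<dots> = h''_const S * (1 / ((a + w') * P) ^ 3)"
    by (simp add: power_mult_distrib power_divide)
  also have "(a + w') * P = real q + P * w'" using P by (simp add: a_def field_simps)
  finally have trap: "norm (of_real (1 / P) * (h s (of_real a) + h s (of_real (a + 1 / P))) / 2
      - (tail s (of_real a) - tail s (of_real (a + 1 / P)))) \<le> h''_const S * (1 / (real q + P * w') ^ 3)"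
    by (simp add: algebra_simps)
  have "norm (complex_of_nat (Suc n) powr (1 - s)) = P powr (1 - Re s)"
    using norm_powr_real_powr[of "complex_of_nat (Suc n)" "1 - s"] by (simp add: P_def)
  also have "\<dots> \<le> P powr (1/2)" using P assms by (intro powr_mono) auto
  also have "\<dots> = sqrt P" using P by (simp add: powr_half_sqrt)
  finally have "norm (trapezoid_defect n q s) \<le> sqrt P * (h''_const S * (1 / (real q + P * w') ^ 3))"
    unfolding trapezoid_defect_def norm_mult P_def[symmetric] a(2)[symmetric] a_def[symmetric] using trap P
    by (intro mult_mono) auto
  also have "\<dots> = h''_const S * (sqrt P / (real q + P * w') ^ 3)" by simp
  also have "\<dots> \<le> h''_const S * ((1 / min 1 w' ^ 3) * (lattice_weight n * lattice_weight q))"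
    unfolding P_def using C0 by (intro mult_left_mono shifted_lattice_bound w'_pos)
  finally show ?thesis by (simp add: trapezoid_defect_bound_def mult.assoc)
qed

definition row_defect :: "nat \<Rightarrow> complex \<Rightarrow> complex" where
  "row_defect n s = (\<Sum>q. trapezoid_defect n q s)"

lemma row_defect_sums:
  assumes "Re s > 1/2"
  shows "(\<lambda>q. trapezoid_defect n q s) sums row_defect n s"
  unfolding row_defect_def
proof (rule summable_sums, rule summable_comparison_test')
  show "summable (\<lambda>q. trapezoid_defect_bound (norm s) * (lattice_weight n * lattice_weight q))"
    by (intro summable_mult lattice_weight_summable)
qed (rule norm_trapezoid_defect_le[OF assms order_refl])

lemma row_defect_summable:
  assumes "Re s > 1/2"
  shows "summable (\<lambda>n. row_defect n s)"
proof (rule summable_comparison_test')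
  show "summable (\<lambda>n. (trapezoid_defect_bound (norm s) * lattice_weight n) * suminf lattice_weight)"
    by (intro summable_mult summable_mult2 lattice_weight_summable)
  show "norm (row_defect n s) \<le> (trapezoid_defect_bound (norm s) * lattice_weight n) * suminf lattice_weight" for n
    unfolding row_defect_def
    by (rule suminf_norm_le[OF _ lattice_weight_summable])
       (use norm_trapezoid_defect_le[OF assms order_refl] in \<open>simp add: mult.assoc\<close>)
qed

definition remainder :: "complex \<Rightarrow> complex" where
  "remainder s = (\<Sum>n. row_defect n s)"

lemma remainder_holomorphic: "remainder holomorphic_on {s. Re s > 1/2}"
  unfolding remainder_def[abs_def] row_defect_def
proof (rule holomorphic_double_suminf)
  fix z :: complex assume "z \<in> {s. Re s > 1/2}"
  have "norm (trapezoid_defect n q y) \<le> trapezoid_defect_bound (norm z + 1) * (lattice_weight n * lattice_weight q)"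
    if "y \<in> ball z 1 \<inter> {s. Re s > 1/2}" for n q y
  proof (rule norm_trapezoid_defect_le)
    show "norm y \<le> norm z + 1"
      using that norm_triangle_ineq2[of y z] by (simp add: dist_norm norm_minus_commute)
  qed (use that in simp)
  then show "\<exists>d C. 0 < d \<and> (\<forall>n q. \<forall>y\<in>ball z d \<inter> {s. Re s > 1/2}.
      norm (trapezoid_defect n q y) \<le> C * (lattice_weight n * lattice_weight q))"
    by (intro exI[of _ 1] exI[of _ "trapezoid_defect_bound (norm z + 1)"]) auto
qed (rule open_halfspace_Re_gt trapezoid_defect_holomorphic lattice_weight_summable lattice_weight_nonneg)+

lemma lattice_root_pos:
  "real q + real (Suc n) * w > 0" "real q + real (Suc n) * w' > 0"
  using w_pos w'_pos by (auto intro!: add_nonneg_pos)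

text \<open>
  At \<open>s = 1\<close> partial fractions give \<open>p\<^sup>-\<^sup>1 h(k/p) = 1/(k + p w') - 1/(k + p w)\<close>, and the tail is
  the corresponding difference of logarithms, in which \<open>log p\<close> cancels.
\<close>
lemma trapezoid_defect_1:
  "trapezoid_defect n q 1 = log_defect (of_real (real (Suc n) * w' + real q)) - log_defect (of_real (real (Suc n) * w + real q))"
proof -
  define P where "P = real (Suc n)"
  have P: "P > 0" by (simp add: P_def)
  have h: "of_real (1 / P) * h 1 (of_real (real k / P)) = of_real (1 / (P * w' + real k) - 1 / (P * w + real k))" for k
  proof -
    have pos: "P * w + real k > 0" "P * w' + real k > 0"
      using lattice_root_pos[of k n] by (simp_all add: P_def add.commute)
    have "real k / P + v = (P * v + real k) / P" for v using P by (simp add: field_simps)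
    then have "1 / P * (\<Delta> / ((real k / P + w) * (real k / P + w'))) = P * \<Delta> / ((P * w + real k) * (P * w' + real k))"
      using P by simp
    also have "\<dots> = 1 / (P * w' + real k) - 1 / (P * w + real k)"
      using pos by (simp add: \<Delta>_def diff_frac_eq algebra_simps)
    finally have eq: "1 / P * (\<Delta> / ((real k / P + w) * (real k / P + w'))) = \<dots>" .
    have "real k / P \<ge> 0" using P by simp
    then show ?thesis by (simp only: h_1 of_real_mult[symmetric] eq)
  qed
  have t: "tail 1 (of_real (real k / P)) = of_real (ln (P * w + real k) - ln (P * w' + real k))" for k
  proof -
    have pos: "P * w + real k > 0" "P * w' + real k > 0"
      using lattice_root_pos[of k n] by (simp_all add: P_def add.commute)
    have "real k / P + v = (P * v + real k) / P" for v using P by (simp add: field_simps)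
    then show ?thesis using tail_1[of "real k / P"] P pos by (simp add: ln_div)
  qed
  have L: "log_defect (of_real (P * v + real q))
     = of_real ((1 / (P * v + real q) + 1 / (P * v + real (Suc q))) / 2 - (ln (P * v + real (Suc q)) - ln (P * v + real q)))"
    if "P * v + real q > 0" for v
  proof -
    have "Ln (of_real (P * v + real q)) = of_real (ln (P * v + real q))"
      "Ln (of_real (P * v + real q + 1)) = of_real (ln (P * v + real q + 1))"
      using that by (intro Ln_of_real; simp)+
    then show ?thesis unfolding log_defect_def by (simp add: add_ac)
  qed
  have pos: "P * w + real q > 0" "P * w' + real q > 0"
    using lattice_root_pos[of q n] by (simp_all add: P_def add.commute)
  have "trapezoid_defect n q 1 = (of_real (1 / P) * h 1 (of_real (real q / P)) + of_real (1 / P) * h 1 (of_real (real (Suc q) / P))) / 2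
      - (tail 1 (of_real (real q / P)) - tail 1 (of_real (real (Suc q) / P)))"
    unfolding trapezoid_defect_def P_def[symmetric] by (simp add: P_def distrib_left)
  also have "\<dots> = log_defect (of_real (P * w' + real q)) - log_defect (of_real (P * w + real q))"
    unfolding h t L[OF pos(1)] L[OF pos(2)] of_real_diff[symmetric] of_real_add[symmetric]
    by (simp add: algebra_simps add_divide_distrib diff_divide_distrib)
  finally show ?thesis unfolding P_def .
qed

lemma row_defect_1:
  "row_defect n 1 = digamma_defect (of_real (real (Suc n) * w)) - digamma_defect (of_real (real (Suc n) * w'))"
proof -
  have "(\<lambda>q. log_defect (of_real (real (Suc n) * w' + real q)) - log_defect (of_real (real (Suc n) * w + real q)))
      sums (- digamma_defect (of_real (real (Suc n) * w')) - - digamma_defect (of_real (real (Suc n) * w)))"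
    using w_pos w'_pos by (intro sums_diff log_defect_sums) auto
  then have "(\<lambda>q. trapezoid_defect n q 1) sums
      (- digamma_defect (of_real (real (Suc n) * w')) - - digamma_defect (of_real (real (Suc n) * w)))"
    by (simp only: trapezoid_defect_1)
  then show ?thesis unfolding row_defect_def by (simp add: sums_iff)
qed

section \<open>The double series and its continuation\<close>

lemma Z_term_eq:
  "Z_term w w' s (Suc n, q) = of_nat (Suc n) powr (- s) * h s (of_real (real q / real (Suc n)))"
proof -
  define P where "P = real (Suc n)"
  define u where "u = real q / P"
  have P: "P > 0" by (simp add: P_def)
  have u: "u \<ge> 0" "real q = P * u" using P by (auto simp: u_def)
  have pos: "u + w > 0" "u + w' > 0" using u w_pos w'_pos by auto
  define y where "y = \<Delta> / ((u + w) * (u + w'))"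
  have y: "y > 0" using pos \<Delta>_pos by (simp add: y_def)
  have "P * (w - w') / ((real q + P * w) * (real q + P * w')) = y / P"
    unfolding u(2) y_def \<Delta>_def[symmetric] distrib_left[symmetric] using P by simp
  then have "Z_term w w' s (Suc n, q) = of_real (y / P) powr s"
    unfolding Z_term_def prod.case P_def[symmetric] by (simp only:)
  also have "\<dots> = exp (s * of_real (ln y - ln P))"
    using y P by (simp add: powr_of_real_exp ln_div del: of_real_divide)
  also have "\<dots> = of_real P powr (- s) * of_real y powr s"
    using y P by (simp add: powr_of_real_exp exp_add[symmetric] algebra_simps)
  finally show ?thesis
    using h_of_real[OF u(1), of s] by (simp add: y_def P_def u_def)
qed

lemma h_tendsto_0:
  assumes "Re s > 1/2" "filterlim f at_top sequentially" "\<And>q. f q \<ge> 0"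
  shows "(\<lambda>q. h s (of_real (f q))) \<longlonglongrightarrow> 0"
proof (rule Lim_null_comparison)
  have "filterlim (\<lambda>q. w' + f q) at_top sequentially"
    by (rule filterlim_tendsto_add_at_top[OF tendsto_const assms(2)])
  then have "filterlim (\<lambda>q. f q + w') at_top sequentially" by (simp only: add.commute)
  then show "(\<lambda>q. (1 + \<Delta> / (w * w')) powr norm s * sqrt \<Delta> / (f q + w')) \<longlonglongrightarrow> 0"
    by (intro tendsto_divide_0[OF tendsto_const] filterlim_at_top_imp_at_infinity)
  show "\<forall>\<^sub>F q in sequentially. norm (h s (of_real (f q)))
      \<le> (1 + \<Delta> / (w * w')) powr norm s * sqrt \<Delta> / (f q + w')"
    using norm_h_le assms by (intro always_eventually) auto
qed

text \<open>
  The row identity \<open>\<Sum>\<^sub>q p\<^sup>-\<^sup>s h(q/p) = R\<^sub>p(s) + p\<^sup>-\<^sup>s h(0)/2 + p\<^sup>1\<^sup>-\<^sup>s I(s)\<close>.  A single row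
  converges already for \<open>Re s > 1/2\<close>; the abscissa \<open>2\<close> comes from the summation over \<open>p\<close>.
\<close>
lemma row_sums:
  assumes "Re s > 1/2"
  shows "(\<lambda>q. Z_term w w' s (Suc n, q)) sums
    (row_defect n s + of_nat (Suc n) powr (- s) * h s 0 / 2 + of_nat (Suc n) powr (1 - s) * tail s 0)"
proof -
  define P where "P = real (Suc n)"
  define f where "f q = of_real P powr (- s) * h s (of_real (real q / P))" for q
  define \<Phi> where "\<Phi> q = - (of_real P powr (1 - s) * tail s (of_real (real q / P)))" for q
  have P: "P > 0" by (simp add: P_def)
  have "filterlim (\<lambda>q. real q * (1 / P)) at_top sequentially"
    using P by (intro filterlim_at_top_mult_tendsto_pos[OF tendsto_const _ filterlim_real_sequentially]) simp
  then have lim: "filterlim (\<lambda>q. real q / P) at_top sequentially" by simp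
  have "f \<longlonglongrightarrow> of_real P powr (- s) * 0" unfolding f_def[abs_def]
    using P by (intro tendsto_mult tendsto_const h_tendsto_0 assms lim) auto
  then have 1: "f \<longlonglongrightarrow> 0" by simp
  have "\<Phi> \<longlonglongrightarrow> - (of_real P powr (1 - s) * 0)" unfolding \<Phi>_def[abs_def]
    by (intro tendsto_minus tendsto_mult tendsto_const tail_tendsto_0 assms lim)
  then have 2: "\<Phi> \<longlonglongrightarrow> 0" by simp
  have powr_eq: "of_real P powr (1 - s) * of_real (1 / P) = complex_of_real P powr (- s)"
  proof -
    have "complex_of_real P powr (1 + - s) = of_real P powr 1 * of_real P powr (- s)"
      by (rule powr_add)
    then show ?thesis using P by simp
  qed
  have "trapezoid_defect n q s = (f q + f (Suc q)) / 2 - (\<Phi> (Suc q) - \<Phi> q)" for q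
  proof -
    have "trapezoid_defect n q s = of_real P powr (1 - s) *
       (of_real (1 / P) * (h s (of_real (real q / P)) + h s (of_real (real (Suc q) / P))) / 2
        - (tail s (of_real (real q / P)) - tail s (of_real (real (Suc q) / P))))"
      unfolding trapezoid_defect_def P_def by simp
    also have "\<dots> = (of_real P powr (1 - s) * of_real (1 / P)) * (h s (of_real (real q / P)) + h s (of_real (real (Suc q) / P))) / 2
        - of_real P powr (1 - s) * (tail s (of_real (real q / P)) - tail s (of_real (real (Suc q) / P)))"
      by (simp only: right_diff_distrib mult.assoc times_divide_eq_right)
    also have "\<dots> = (f q + f (Suc q)) / 2 - (\<Phi> (Suc q) - \<Phi> q)"
      unfolding powr_eq f_def \<Phi>_def by (simp add: algebra_simps)
    finally show ?thesis .
  qed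
  with row_defect_sums[OF assms, of n]
  have "(\<lambda>q. (f q + f (Suc q)) / 2 - (\<Phi> (Suc q) - \<Phi> q)) sums row_defect n s" by simp
  from sums_trapezoid[OF 1 2 this]
  show ?thesis unfolding Z_term_eq f_def \<Phi>_def P_def by simp
qed

text \<open>
  The base of the power is \<open>O(p / (p + q)\<^sup>2)\<close>, hence \<open>O(1 / (p + q))\<close>, and \<open>p + q\<close> is at least
  the geometric mean of \<open>p\<close> and \<open>q + 1\<close>.
\<close>
lemma norm_Z_term_le:
  assumes "Re s > 0"
  shows "norm (Z_term w w' s (Suc n, q)) \<le>
    (\<Delta> / (min 1 w')\<^sup>2) powr Re s * (real (Suc n) powr (- Re s / 2) * real (Suc q) powr (- Re s / 2))"
proof -
  define P Q N where "P = real (Suc n)" and "Q = real (Suc q)" and "N = real (Suc n) + real q"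
  define \<kappa> where "\<kappa> = min 1 w'"
  define y where "y = P * \<Delta> / ((real q + P * w) * (real q + P * w'))"
  have PQ: "P > 0" "Q > 0" "N > 0" "P \<le> N" "Q \<le> N" by (auto simp: P_def Q_def N_def)
  have \<kappa>: "\<kappa> > 0" "\<kappa> \<le> 1" "\<kappa> \<le> w'" "\<kappa> \<le> w" using w'_pos w'_less by (auto simp: \<kappa>_def)
  have N_le: "\<kappa> * N \<le> real q + P * v" if "\<kappa> \<le> v" for v
    using mult_right_mono[OF \<kappa>(2) of_nat_0_le_iff, of q] mult_right_mono[OF that of_nat_0_le_iff, of "Suc n"]
    unfolding N_def P_def distrib_left mult.commute[of "real (Suc n)"] by linarith
  have pos: "real q + P * w > 0" "real q + P * w' > 0" unfolding P_def by (rule lattice_root_pos)+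
  have y: "y > 0" unfolding y_def using PQ pos \<Delta>_pos by simp
  have "(\<kappa> * N) * (\<kappa> * N) \<le> (real q + P * w) * (real q + P * w')"
    using N_le \<kappa> PQ pos by (intro mult_mono) auto
  then have "y \<le> P * \<Delta> / ((\<kappa> * N) * (\<kappa> * N))"
    unfolding y_def using PQ \<kappa> \<Delta>_pos pos by (intro divide_left_mono mult_pos_pos) auto
  also have "\<dots> = (\<Delta> / \<kappa>\<^sup>2) * (P / N) * (1 / N)"
    by (simp add: power2_eq_square mult_ac)
  also have "\<dots> \<le> (\<Delta> / \<kappa>\<^sup>2) * 1 * (P powr (-1/2) * Q powr (-1/2))"
  proof (intro mult_mono)
    have "P powr (1/2) * Q powr (1/2) \<le> N powr (1/2) * N powr (1/2)"
      using PQ by (intro mult_mono powr_mono2) auto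
    also have "\<dots> = N" using PQ by (simp flip: powr_add)
    finally have "1 / N \<le> 1 / (P powr (1/2) * Q powr (1/2))" using PQ by (intro divide_left_mono) auto
    then show "1 / N \<le> P powr (-1/2) * Q powr (-1/2)"
      using PQ by (simp add: powr_minus_divide)
  qed (use PQ \<kappa> \<Delta>_pos in auto)
  finally have y_le: "y \<le> (\<Delta> / \<kappa>\<^sup>2) * (P powr (-1/2) * Q powr (-1/2))" by simp
  have "norm (Z_term w w' s (Suc n, q)) = y powr Re s"
    unfolding Z_term_def prod.case y_def \<Delta>_def[symmetric] P_def[symmetric]
    by (subst norm_powr_real_powr) (use y in \<open>auto simp: y_def\<close>)
  also have "\<dots> \<le> ((\<Delta> / \<kappa>\<^sup>2) * (P powr (-1/2) * Q powr (-1/2))) powr Re s"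
    using y y_le assms by (intro powr_mono2) auto
  also have "\<dots> = (\<Delta> / \<kappa>\<^sup>2) powr Re s * (P powr (- Re s / 2) * Q powr (- Re s / 2))"
    using PQ \<kappa> \<Delta>_pos by (simp add: powr_mult powr_powr del: times_divide_eq_left times_divide_eq_right) simp
  finally show ?thesis unfolding P_def Q_def \<kappa>_def .
qed

lemma Z_summable:
  assumes "Re s > 2"
  shows "Z_term w w' s summable_on pq_pairs"
proof -
  define C where "C = (\<Delta> / (min 1 w')\<^sup>2) powr Re s"
  define g where "g p = C * (real p powr (- Re s / 2) * (\<Sum>q. real (Suc q) powr (- Re s / 2)))" for p
  define b where "b = (\<lambda>(p, q). C * (real p powr (- Re s / 2) * real (Suc q) powr (- Re s / 2)))"
  have s: "summable (\<lambda>q. real (Suc q) powr (- Re s / 2))"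
    using assms by (intro summable_Suc_powr) simp
  have "b summable_on pq_pairs" unfolding pq_pairs_def
  proof (rule summable_on_SigmaI)
    fix p :: nat
    show "((\<lambda>q. b (p, q)) has_sum g p) UNIV"
    proof (rule sums_nonneg_imp_has_sum)
      show "(\<lambda>q. b (p, q)) sums g p"
        unfolding b_def g_def prod.case by (intro sums_mult summable_sums s)
      show "b (p, q) \<ge> 0" for q by (simp add: b_def C_def)
    qed
    show "b (p, q) \<ge> 0" for q by (simp add: b_def C_def)
  next
    have "summable (\<lambda>p. norm (g p))"
      unfolding g_def norm_mult using assms
      by (intro summable_mult summable_mult2) (simp add: summable_real_powr_iff)
    then have "g summable_on UNIV" by (rule norm_summable_imp_summable_on)
    then show "g summable_on {1..}" by (rule summable_on_subset_banach) simp
  qed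
  then have "(\<lambda>pq. norm (Z_term w w' s pq)) summable_on pq_pairs"
  proof (rule Infinite_Sum.abs_summable_on_comparison_test')
    fix pq :: "nat \<times> nat" assume "pq \<in> pq_pairs"
    then obtain n q where "pq = (Suc n, q)"
      by (cases pq; cases "fst pq") (auto simp: pq_pairs_def)
    then show "norm (Z_term w w' s pq) \<le> b pq"
      using norm_Z_term_le[of s n q] assms by (simp add: b_def C_def)
  qed
  then show ?thesis by (rule abs_summable_summable)
qed

lemma Z_rows_sums:
  assumes "Re s > 2"
  shows "(\<lambda>n. row_defect n s + of_nat (Suc n) powr (- s) * h s 0 / 2 + of_nat (Suc n) powr (1 - s) * tail s 0)
    sums Z s w w'"
proof -
  define f where "f = (\<lambda>p. \<Sum>\<^sub>\<infinity>q. Z_term w w' s (p, q))"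
  have sZ: "(\<lambda>(p, q). Z_term w w' s (p, q)) summable_on Sigma {1..} (\<lambda>_. UNIV)"
    using Z_summable[OF assms] unfolding pq_pairs_def by simp
  have img: "{1..} = range Suc" by (auto simp: image_iff Suc_le_eq gr0_conv_Suc)
  have "f summable_on {1..}" "infsum f {1..} = Z s w w'"
    unfolding f_def Z_def using summable_on_Sigma_banach[OF sZ] infsum_Sigma'_banach[OF sZ]
    by (simp_all add: pq_pairs_def)
  then have "(f has_sum Z s w w') {1..}" using has_sum_infsum by metis
  then have "((f \<circ> Suc) has_sum Z s w w') UNIV" unfolding img by (simp add: has_sum_reindex)
  then have "(f \<circ> Suc) sums Z s w w'" by (rule has_sum_imp_sums)
  moreover have "f (Suc n) = row_defect n s + of_nat (Suc n) powr (- s) * h s 0 / 2 + of_nat (Suc n) powr (1 - s) * tail s 0" for n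
  proof -
    have "(\<lambda>(p, q). Z_term w w' s (p, q)) summable_on Sigma {Suc n} (\<lambda>_. UNIV)"
      by (rule summable_on_subset_banach[OF sZ]) auto
    then have "(\<lambda>(p, q). Z_term w w' s (p, q)) summable_on Pair (Suc n) ` UNIV"
      by (rule back_subst) auto
    then have "(\<lambda>q. Z_term w w' s (Suc n, q)) summable_on UNIV"
      by (subst (asm) summable_on_reindex) (auto simp: inj_on_def o_def)
    then have "((\<lambda>q. Z_term w w' s (Suc n, q)) has_sum f (Suc n)) UNIV"
      unfolding f_def by (rule has_sum_infsum)
    then have "(\<lambda>q. Z_term w w' s (Suc n, q)) sums f (Suc n)" by (rule has_sum_imp_sums)
    then show ?thesis using row_sums[of s n] assms by (intro sums_unique2) auto
  qed
  ultimately show ?thesis by (simp add: o_def)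
qed

text \<open>
  The function \<open>\<zeta>(s - 1) I(s) + \<zeta>(s) h(0)/2 + R(s)\<close>.
\<close>
definition continuation :: "complex \<Rightarrow> complex" where
  "continuation s = (1 / (s - 2) + zeta_regular (s - 1)) * tail s 0
     + (1 / (s - 1) + zeta_regular s) * h s 0 / 2 + remainder s"

lemma continuation_eq_Z:
  assumes "Re s > 2"
  shows "continuation s = Z s w w'"
proof -
  have 1: "(\<lambda>n. of_nat (Suc n) powr (- s)) sums (1 / (s - 1) + zeta_regular s)"
    using assms by (intro zeta_sums) simp
  have "(\<lambda>n. of_nat (Suc n) powr (- (s - 1))) sums (1 / (s - 1 - 1) + zeta_regular (s - 1))"
    using assms by (intro zeta_sums) simp
  then have 2: "(\<lambda>n. of_nat (Suc n) powr (1 - s)) sums (1 / (s - 2) + zeta_regular (s - 1))"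
    by (simp del: of_nat_Suc)
  have 3: "(\<lambda>n. row_defect n s) sums remainder s"
    unfolding remainder_def using assms by (intro summable_sums row_defect_summable) simp
  have "(\<lambda>n. row_defect n s + of_nat (Suc n) powr (- s) * h s 0 / 2 + of_nat (Suc n) powr (1 - s) * tail s 0) sums
      (remainder s + (1 / (s - 1) + zeta_regular s) * h s 0 / 2 + (1 / (s - 2) + zeta_regular (s - 1)) * tail s 0)"
    by (intro sums_add sums_mult2 sums_divide 1 2 3)
  with Z_rows_sums[OF assms] have "remainder s + (1 / (s - 1) + zeta_regular s) * h s 0 / 2
      + (1 / (s - 2) + zeta_regular (s - 1)) * tail s 0 = Z s w w'" by (intro sums_unique2)
  then show ?thesis by (simp add: continuation_def algebra_simps)
qed

lemma pieces_holomorphic [holomorphic_intros]: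
  assumes "S \<subseteq> {s. Re s > 1/2}"
  shows "(\<lambda>s. tail s 0) holomorphic_on S" "(\<lambda>s. h s 0) holomorphic_on S"
    "zeta_regular holomorphic_on S" "(\<lambda>s. zeta_regular (s - 1)) holomorphic_on S"
    "remainder holomorphic_on S"
proof -
  show "(\<lambda>s. tail s 0) holomorphic_on S"
    using tail_holomorphic[of 0] assms by (auto intro: holomorphic_on_subset)
  show "(\<lambda>s. h s 0) holomorphic_on S" unfolding h_def by (intro holomorphic_intros)
  show "zeta_regular holomorphic_on S"
    by (rule holomorphic_on_subset[OF zeta_regular_holomorphic]) (use assms in force)
  have "(zeta_regular \<circ> (\<lambda>s. s - 1)) holomorphic_on S"
    by (rule holomorphic_on_compose_gen[OF _ zeta_regular_holomorphic])
       (use assms in \<open>force intro!: holomorphic_intros\<close>)+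
  then show "(\<lambda>s. zeta_regular (s - 1)) holomorphic_on S" by (simp add: o_def)
  show "remainder holomorphic_on S"
    by (rule holomorphic_on_subset[OF remainder_holomorphic assms])
qed

lemma continuation_holomorphic: "continuation holomorphic_on ({s. Re s > 1/2} - {1, 2})"
  unfolding continuation_def[abs_def] by (intro holomorphic_intros) auto

lemma punctured_halfplane_open: "open ({s. Re s > 1/2} - {z})"
  by (intro open_Diff open_halfspace_Re_gt) auto

lemma continuation_pole_2: "is_pole continuation 2" "zorder continuation 2 = - 1"
proof -
  define S where "S = {s. Re s > 1/2} - {1 :: complex}"
  define g where "g s = tail s 0 + (s - 2) * (zeta_regular (s - 1) * tail s 0
      + (1 / (s - 1) + zeta_regular s) * h s 0 / 2 + remainder s)" for s
  have S: "open S" "2 \<in> S" unfolding S_def by (rule punctured_halfplane_open, simp)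
  have g: "g holomorphic_on S" unfolding g_def[abs_def] S_def by (intro holomorphic_intros) auto
  have g2: "g 2 \<noteq> 0" using tail_2_nonzero by (simp add: g_def)
  have "continuation s = g s / (s - 2)" if "s \<in> S" "s \<noteq> 2" for s
  proof -
    have "s - 2 \<noteq> 0" using that by simp
    then have "g s / (s - 2) = tail s 0 / (s - 2) + (zeta_regular (s - 1) * tail s 0
        + (1 / (s - 1) + zeta_regular s) * h s 0 / 2 + remainder s)"
      unfolding g_def add_divide_distrib[of "tail s 0"] by simp
    then show ?thesis by (simp add: continuation_def distrib_right)
  qed
  note * = simple_poleI[OF S g g2 this]
  show "is_pole continuation 2" "zorder continuation 2 = - 1" by (rule *; assumption)+
qed

lemma continuation_pole_1: "is_pole continuation 1" "zorder continuation 1 = - 1"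
proof -
  define S where "S = {s. Re s > 1/2} - {2 :: complex}"
  define g where "g s = h s 0 / 2 + (s - 1) * ((1 / (s - 2) + zeta_regular (s - 1)) * tail s 0
      + zeta_regular s * h s 0 / 2 + remainder s)" for s
  have S: "open S" "1 \<in> S" unfolding S_def by (rule punctured_halfplane_open, simp)
  have g: "g holomorphic_on S" unfolding g_def[abs_def] S_def by (intro holomorphic_intros) auto
  have g1: "g 1 \<noteq> 0" using h_1[of 0] \<Delta>_pos w_pos w'_pos by (simp add: g_def)
  have "continuation s = g s / (s - 1)" if "s \<in> S" "s \<noteq> 1" for s
  proof -
    have "s - 1 \<noteq> 0" using that by simp
    then have "g s / (s - 1) = h s 0 / 2 / (s - 1) + ((1 / (s - 2) + zeta_regular (s - 1)) * tail s 0
        + zeta_regular s * h s 0 / 2 + remainder s)"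
      unfolding g_def add_divide_distrib[of "h s 0 / 2"] by simp
    moreover have "(1 / (s - 1) + zeta_regular s) * h s 0 / 2 = h s 0 / 2 / (s - 1) + zeta_regular s * h s 0 / 2"
      by (simp add: distrib_right add_divide_distrib)
    ultimately show ?thesis by (simp add: continuation_def)
  qed
  note * = simple_poleI[OF S g g1 this]
  show "is_pole continuation 1" "zorder continuation 1 = - 1" by (rule *; assumption)+
qed

text \<open>
  Subtracting the polar part leaves a function that is holomorphic at \<open>1\<close> once the difference quotient
  \<open>(h\<^sub>s(0) - h\<^sub>1(0)) / (s - 1)\<close> is completed by the derivative \<open>c log c\<close>.  Its value at \<open>1\<close> is the
  constant term, and a holomorphic function differs from its value at \<open>1\<close> by \<open>O(s - 1)\<close>.
\<close>
lemma continuation_laurent_1: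
  "(\<lambda>s. continuation s - (of_real ((w - w') / (2 * w * w')) / (s - 1) + Ptilde (of_real w) (of_real w')))
     \<in> O[at 1](\<lambda>s. s - 1)"
proof -
  define c where "c = \<Delta> / (w * w')"
  have c: "c > 0" using \<Delta>_pos w_pos w'_pos by (simp add: c_def)
  have h0: "h s 0 = of_real c powr s" for s
    using h_of_real[of 0 s] by (simp add: c_def)
  define D where "D s = (if s = 1 then deriv (\<lambda>s. h s 0) 1 else (h s 0 - h 1 0) / (s - 1))" for s
  define A where "A s = (1 / (s - 2) + zeta_regular (s - 1)) * tail s 0 + zeta_regular s * h s 0 / 2
      + remainder s + D s / 2" for s
  have "D holomorphic_on UNIV" unfolding D_def h_def
    by (intro pole_lemma holomorphic_intros) auto
  then have D: "D holomorphic_on S" for S by (rule holomorphic_on_subset) simp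
  have A: "A holomorphic_on ({s. Re s > 1/2} - {2})"
    unfolding A_def[abs_def] by (intro holomorphic_intros D) auto
  have "((\<lambda>s. h s 0) has_field_derivative of_real c * of_real (ln c)) (at 1)"
    unfolding h0 using c by (auto intro!: derivative_eq_intros simp: Ln_of_real)
  then have D1: "D 1 = of_real (c * ln c)" by (simp add: D_def DERIV_imp_deriv)
  have "A 1 = Ptilde (of_real w) (of_real w')"
  proof -
    have "remainder 1 = (\<Sum>n. digamma_defect (of_real (real (Suc n) * w)) - digamma_defect (of_real (real (Suc n) * w')))"
      unfolding remainder_def row_defect_1 ..
    then have F: "F1 (of_real w) - F1 (of_real w') = remainder 1 - of_real (ln (w / w')) / 2"
      using F1_diff[OF w_pos w'_pos] by simp
    have t: "tail 1 0 = of_real (ln (w / w'))"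
      using tail_1[of 0] w_pos w'_pos by (simp add: ln_div)
    have e1: "(of_real w - of_real w') / (of_real w * of_real w') = complex_of_real c"
      by (simp add: c_def \<Delta>_def)
    have e2: "(of_real w - of_real w') / (2 * of_real w * of_real w') = complex_of_real c / 2"
      unfolding e1[symmetric] divide_divide_eq_left by (simp only: mult_ac)
    have P: "Ptilde (of_real w) (of_real w') = remainder 1 - of_real (ln (w / w')) / 2
        + of_real c / 2 * (euler_mascheroni + of_real (ln c))"
      unfolding Ptilde_def F e1 e2 Ln_of_real[OF c] ..
    show ?thesis unfolding P A_def D1 t
      by (simp add: h0 zeta_regular_0 zeta_regular_1 algebra_simps add_divide_distrib)
  qed
  moreover have "(\<lambda>s. A s - A 1) \<in> O[at 1](\<lambda>s. s - 1)"
    by (rule holomorphic_diff_bigo[OF A punctured_halfplane_open]) auto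
  moreover have "\<forall>\<^sub>F s in at 1. continuation s - (of_real ((w - w') / (2 * w * w')) / (s - 1) + Ptilde (of_real w) (of_real w'))
      = A s - Ptilde (of_real w) (of_real w')"
  proof -
    have "continuation s = A s + of_real ((w - w') / (2 * w * w')) / (s - 1)" if "s \<noteq> 1" for s
    proof -
      have e1: "of_real ((w - w') / (2 * w * w')) = h 1 0 / 2"
        using c by (simp add: h0 c_def \<Delta>_def)
      have e2: "h s 0 / (s - 1) = D s + h 1 0 / (s - 1)"
        using that by (simp add: D_def flip: add_divide_distrib)
      have "(1 / (s - 1) + zeta_regular s) * h s 0 / 2 = h s 0 / (s - 1) / 2 + zeta_regular s * h s 0 / 2"
        by (simp add: distrib_right add_divide_distrib)
      also have "h s 0 / (s - 1) / 2 = D s / 2 + h 1 0 / 2 / (s - 1)"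
        unfolding e2 add_divide_distrib divide_divide_eq_left by (simp only: mult.commute)
      finally show ?thesis unfolding continuation_def A_def e1 by simp
    qed
    then show ?thesis by (auto simp: eventually_at_filter)
  qed
  ultimately show ?thesis by (subst landau_o.big.in_cong) auto
qed

end

section \<open>Class decomposition, continuation and Laurent expansion\<close>

theorem theorem4p2:
  shows
    "(\<forall>(K :: real set) (D :: int) (\<B> :: real set set) (bs :: int list) (s :: complex).
        real_quadratic_field K \<and> D = field_discriminant K \<and> D > 0 \<and>
        \<B> \<in> narrow_ideal_classes K \<and> has_cycle K \<B> bs \<and> Re s > 2 \<longrightarrow>
        of_int D powr (s / 2) * partial_zeta K s \<B> =
          (\<Sum>k = 1..length bs. Z s (cycle_number bs k) (conj_in K (cycle_number bs k))))
     \<and>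
     (\<forall>(a :: real) (b :: real) (c :: real) (w :: real) (w' :: real).
        a > 0 \<and> b > 0 \<and> c > 0 \<and> b\<^sup>2 - 4 * a * c = 1 \<and>
        c * w\<^sup>2 - b * w + a = 0 \<and> c * w'\<^sup>2 - b * w' + a = 0 \<and> w > w' \<longrightarrow>
        w' > 0 \<and>
        (\<forall>x y :: real. a * x\<^sup>2 + b * x * y + c * y\<^sup>2 =
           1 / (w - w') * ((y + x * w) * (y + x * w'))) \<and>
        (\<forall>s :: complex. Re s > 2 \<longrightarrow> Z_term w w' s summable_on pq_pairs) \<and>
        (\<exists>F :: complex \<Rightarrow> complex.
           F holomorphic_on ({s. Re s > 1 / 2} - {1, 2}) \<and>
           (\<forall>s. Re s > 2 \<longrightarrow> F s = Z s w w') \<and>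
           is_pole F 1 \<and> zorder F 1 = - 1 \<and>
           is_pole F 2 \<and> zorder F 2 = - 1 \<and>
           (\<lambda>s. F s - (of_real ((w - w') / (2 * w * w')) / (s - 1)
                       + Ptilde (of_real w) (of_real w')))
             \<in> O[at 1](\<lambda>s. s - 1)))"
proof (intro conjI allI impI; (elim conjE)?)
  fix K :: "real set" and D \<B> bs and s :: complex
  assume D: "D = field_discriminant K" "D > 0" and cyc: "has_cycle K \<B> bs"
  have row: "(\<Sum>\<^sub>\<infinity>(p, q)\<in>pq_pairs. of_nat p powr s / of_real (reduced_form K w (real p) (real q)) powr s)
      = Z s w (conj_in K w)" if "w \<in> reduced_numbers K \<B>" for w
    unfolding Z_def
  proof (rule infsum_cong)
    fix pq :: "nat \<times> nat" assume "pq \<in> pq_pairs"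
    then obtain p q where pq: "pq = (p, q)" "real p > 0" by (auto simp: pq_pairs_def)
    define v where "v = conj_in K w"
    have v: "0 < v" "v < w" using that by (auto simp: reduced_numbers_def is_reduced_def v_def)
    define x where "x = reduced_form K w (real p) (real q)"
    have x: "x > 0" unfolding x_def reduced_form_def v_def[symmetric] using v pq(2)
      by (intro mult_pos_pos add_nonneg_pos divide_pos_pos) auto
    have "real p / x = real p * (w - v) / ((real q + real p * w) * (real q + real p * v))"
      unfolding x_def reduced_form_def v_def by simp
    then have "Z_term w v s pq = of_real (real p / x) powr s" by (simp add: Z_term_def pq(1))
    also have "\<dots> = of_real (real p) powr s / of_real x powr s"
      using x pq(2) by (simp add: powr_of_real_exp ln_div right_diff_distrib exp_diff del: of_real_divide of_real_of_nat_eq)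
    finally show "(case pq of (p, q) \<Rightarrow> of_nat p powr s / of_real (reduced_form K w (real p) (real q)) powr s)
        = Z_term w (conj_in K w) s pq" by (simp add: pq(1) x_def v_def)
  qed
  have bij: "bij_betw (cycle_number bs) {1..length bs} (reduced_numbers K \<B>)"
    using cyc by (simp add: has_cycle_def)
  have "of_int D powr (s / 2) \<noteq> (0::complex)" using D(2) by simp
  then have "of_int D powr (s / 2) * partial_zeta K s \<B> = (\<Sum>w\<in>reduced_numbers K \<B>. Z s w (conj_in K w))"
    unfolding partial_zeta_def D(1)[symmetric] using row by (simp cong: sum.cong)
  also have "\<dots> = (\<Sum>k = 1..length bs. Z s (cycle_number bs k) (conj_in K (cycle_number bs k)))"
    by (rule sum.reindex_bij_betw[OF bij, symmetric])
  finally show "of_int D powr (s / 2) * partial_zeta K s \<B> =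
      (\<Sum>k = 1..length bs. Z s (cycle_number bs k) (conj_in K (cycle_number bs k)))" .
next
  fix a b c w w' :: real
  assume pos: "a > 0" "b > 0" "c > 0" and disc: "b\<^sup>2 - 4 * a * c = 1"
    and roots: "c * w\<^sup>2 - b * w + a = 0" "c * w'\<^sup>2 - b * w' + a = 0" and less: "w > w'"
  \<comment> \<open>Vieta's formulas; the discriminant then says that \<open>c (w - w') = 1\<close>.\<close>
  have "(w - w') * (c * (w + w') - b) = 0" using roots by (simp add: algebra_simps power2_eq_square)
  then have b: "b = c * (w + w')" using less by simp
  have a: "a = c * (w * w')" using roots(1) unfolding b by (simp add: algebra_simps power2_eq_square)
  have "w * w' > 0" "w + w' > 0" using pos unfolding a b by (simp_all add: zero_less_mult_iff)
  then show w': "w' > 0" using less by (auto simp: zero_less_mult_iff)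
  have "(c * (w - w'))\<^sup>2 = 1" using disc unfolding a b by (simp add: algebra_simps power2_eq_square)
  moreover have "c * (w - w') > 0" using pos less by simp
  ultimately have "c * (w - w') = 1" unfolding power2_eq_1_iff by auto
  then have c: "1 / (w - w') = c" using less by (simp add: field_simps)
  show "a * x\<^sup>2 + b * x * y + c * y\<^sup>2 = 1 / (w - w') * ((y + x * w) * (y + x * w'))" for x y
    unfolding c a b by (simp add: algebra_simps power2_eq_square)
  interpret root_pair w w' using w' less by unfold_locales
  show "Z_term w w' s summable_on pq_pairs" if "Re s > 2" for s using that by (rule Z_summable)
  show "\<exists>F. F holomorphic_on ({s. Re s > 1 / 2} - {1, 2}) \<and>
           (\<forall>s. Re s > 2 \<longrightarrow> F s = Z s w w') \<and>
           is_pole F 1 \<and> zorder F 1 = - 1 \<and>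
           is_pole F 2 \<and> zorder F 2 = - 1 \<and>
           (\<lambda>s. F s - (of_real ((w - w') / (2 * w * w')) / (s - 1)
                       + Ptilde (of_real w) (of_real w')))
             \<in> O[at 1](\<lambda>s. s - 1)"
    using continuation_holomorphic continuation_eq_Z continuation_pole_1 continuation_pole_2 continuation_laurent_1
    by (intro exI[of _ continuation]) simp
qed

end
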